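(* Suppose the objective $F$ and the stochastic gradients satisfy the lower boundedness, joint $(\mathcal L_0,\mathcal L_1,q)$-smoothness and layer-wise variance assumptions stated in the context. Let $\{X_t\}_{t=1}^{T+1}$ be generated by layer-wise Muon (see context) with $\beta_1\in[0,1)$, $\beta_2\in[0,1]$ and $\gamma>0$. For each layer $l$, let $r^{(l)}$ bound both $\mathrm{rank}(N_t^{(l)})$ and $\mathrm{rank}(N_t^{(l)}-\nabla_{(l)}F(X_t))$ along the iterates, and let the orthogonalization routine satisfy the spectral condition of the context with fixed constants $\varsigma_{\min}>0$ and $\varsigma_{\max}>0$, uniformly over all layers and iterates. Define $\hat{\mathcal L}=\mathcal L_0+(1-q)\mathcal L_1$, $R_0=\sum_{l=1}^L r^{(l)}$, $S_0=\sum_{l=1}^L\sqrt{r^{(l)}}\,\sigma_{(l)}$, $G_0=\sum_{l=1}^L\sqrt{r^{(l)}}\,\|\nabla_{(l)}F(X_1)\|_{\mathsf F}$, and $$\Delta_{\gamma,\beta_1}:=\varsigma_{\min}-\frac{\gamma\varsigma_{\max}^2q\mathcal L_1R_0}{2}-\frac{2\gamma\varsigma_{\max}^2q\mathcal L_1R_0}{1-\beta_1}.$$ Then $$\begin{aligned} \Delta_{\gamma,\beta_1}\frac1T\sum_{t=1}^T\sum_{l=1}^L\mathbb E\left[\|\nabla_{(l)}F(X_t)\|_*\right] \le{}&\frac{F(X_1)-F^*}{\gamma T}+\frac{2\beta_2\varsigma_{\max}G_0}{T(1-\beta_1)}\\ &+2\left(\sqrt{1-\beta_1}+\sqrt{2\beta_1(1-\beta_1\beta_2)(1-\beta_2)}\right)\varsigma_{\max}S_0\\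 &+\frac{2\gamma\beta_2\varsigma_{\max}^2\hat{\mathcal L}}{1-\beta_1}R_0+\frac{\gamma\varsigma_{\max}^2\hat{\mathcal L}R_0}{2}. \end{aligned}$$
   Context: Parameter space: $\mathcal S=\mathbb R^{n_1\times m_1}\times\cdots\times\mathbb R^{n_L\times m_L}$; $X=(X^{(1)},\dots,X^{(L)})$, with $\|X\|_{\mathsf F}^2=\sum_{l=1}^L\|X^{(l)}\|_{\mathsf F}^2$ ($\|\cdot\|_{\mathsf F}$ is the Frobenius norm, $\|\cdot\|_*$ the nuclear norm). The objective is $F(X)=\mathbb E_\xi[f(X;\xi)]$; $\nabla_{(l)}$ denotes the gradient block with respect to $X^{(l)}$. Assumptions. (Lower boundedness) There is $F^*>-\infty$ with $F(X)\ge F^*$ for all $X\in\mathcal S$. (Joint smoothness) $F:\mathcal S\to\mathbb R$ is differentiable and, for some $\mathcal L_0>0$, $\mathcal L_1\ge0$, $q\in[0,1]$ and all $X,Y\in\mathcal S$, $\|\nabla F(X)-\nabla F(Y)\|_{\mathsf F}\le(\mathcal L_0+\mathcal L_1\|\nabla F(X)\|_{\mathsf F}^q)\|X-Y\|_{\mathsf F}$; for $q=0$ the power is interpreted as $1$, including at a zero gradient. (Layer-wise variance) For each $l$ there is $\sigma_{(l)}\ge0$ such that for all $X\in\mathcal S$: $\mathbb E_\xi[\nabla_{(l)}f(X;\xi)]=\nabla_{(l)}F(X)$ and $\mathbb E_\xi\|\nabla_{(l)}f(X;\xi)-\nabla_{(l)}F(X)\|_{\mathsf F}^2\le\sigma_{(l)}^2$.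 At iteration $t$, the sample $\xi_t$ is independent of the past $\mathcal F_{t-1}$ (the $\sigma$-field of the history before step $t$, with respect to which $X_t$ is measurable), so the same statements hold conditionally on $\mathcal F_{t-1}$ at $X=X_t$. Noise in different layers need not be independent. Algorithm (layer-wise Muon). $X_1\in\mathcal S$ is a given deterministic point and $M_0^{(l)}=0$. For $t=1,\dots,T$ and each $l=1,\dots,L$: $G_t^{(l)}=\nabla_{(l)}f(X_t;\xi_t)$; $M_t^{(l)}=\beta_1M_{t-1}^{(l)}+(1-\beta_1)G_t^{(l)}$; $N_t^{(l)}=\beta_2M_t^{(l)}+(1-\beta_2)G_t^{(l)}$; $O_t^{(l)}=$ orthogonalization routine applied to $N_t^{(l)}$; $X_{t+1}^{(l)}=X_t^{(l)}-\gamma O_t^{(l)}$. All gradient blocks at step $t$ are evaluated at the same $X_t$. Spectral condition on the orthogonalization routine with constants $\varsigma_{\min},\varsigma_{\max}$: if $N_t^{(l)}\neq0$ has compact SVD $U\Sigma V^\top$ of rank $r$, then $O_t^{(l)}=U\,\mathrm{diag}(\varsigma_1,\dots,\varsigma_r)V^\top$ with $\varsigma_{\min}\le\varsigma_i\le\varsigma_{\max}$ for all $i$; consequently $\langle N_t^{(l)},O_t^{(l)}\rangle\ge\varsigma_{\min}\|N_t^{(l)}\|_*$ and $\|O_t^{(l)}\|_{\mathsf F}\le\varsigma_{\max}\sqrt r$. If $N_t^{(l)}=0$ then $O_t^{(l)}=0$. *)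

theory Defs
  imports "HOL-Probability.Probability"
begin

text \<open>
  The layers are indexed by a finite type \<open>'l\<close>.  Since the shapes \<open>n\<^sub>l \<times> m\<^sub>l\<close> vary with the layer,
  every block is embedded, padded by zeros, into one common matrix type: \<open>I l\<close> and \<open>J l\<close> are the row
  and column index sets of layer \<open>l\<close>, so that \<open>n\<^sub>l = card (I l)\<close> and \<open>m\<^sub>l = card (J l)\<close>.  Every finite
  family of shapes arises in this way.  Padding changes neither inner products, ranks, compact
  singular value decompositions nor nuclear norms.  The library norm on \<open>real^'m^'n\<close> is the
  Frobenius norm, and the one on \<open>real^'m^'n^'l\<close> is the joint Frobenius norm over all layers.
\<close>

definition param_space ::
    "('l::finite \<Rightarrow> 'n::finite set) \<Rightarrow> ('l \<Rightarrow> 'm::finite set) \<Rightarrow> (real^'m^'n^'l) set" where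
  "param_space I J = {X. \<forall>l i j. i \<notin> I l \<or> j \<notin> J l \<longrightarrow> X $ l $ i $ j = 0}"

text \<open>
  The gradient at \<open>X\<close> of a function on the linear subspace \<open>S\<close>.  Values of the function outside \<open>S\<close>
  are irrelevant, and requiring \<open>G \<in> S\<close> makes \<open>G\<close> unique.  The gradient block of layer \<open>l\<close> is
  \<open>grad S h X $ l\<close>.
\<close>

definition grad :: "'a::euclidean_space set \<Rightarrow> ('a \<Rightarrow> real) \<Rightarrow> 'a \<Rightarrow> 'a" where
  "grad S h X = (THE G. G \<in> S \<and> (h has_derivative (\<lambda>H. G \<bullet> H)) (at X within S))"

lemma grad_eqI:
  fixes S :: "'a::euclidean_space set"
  assumes S: "subspace S" and X: "X \<in> S" and G: "G \<in> S"
    and D: "(h has_derivative (\<lambda>H. G \<bullet> H)) (at X within S)"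
  shows "grad S h X = G"
  unfolding grad_def
proof (rule the_equality)
  show "G \<in> S \<and> (h has_derivative (\<lambda>H. G \<bullet> H)) (at X within S)"
    using G D by blast
next
  fix K assume K: "K \<in> S \<and> (h has_derivative (\<lambda>H. K \<bullet> H)) (at X within S)"
  define H where "H = K - G"
  have HS: "H \<in> S" using K G S by (simp add: H_def subspace_diff)
  have line: "((\<lambda>s::real. X + s *\<^sub>R H) has_derivative (\<lambda>s. s *\<^sub>R H)) (at 0)"
    by (auto intro!: derivative_eq_intros)
  have sub: "range (\<lambda>s::real. X + s *\<^sub>R H) \<subseteq> S"
    using S X HS by (auto simp: subspace_add subspace_scale)
  have *: "((\<lambda>s. h (X + s *\<^sub>R H)) has_derivative (\<lambda>s. A \<bullet> (s *\<^sub>R H))) (at 0)"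
    if "(h has_derivative (\<lambda>H. A \<bullet> H)) (at X within S)" for A
  proof -
    have "(h has_derivative (\<lambda>H. A \<bullet> H))
        (at (X + 0 *\<^sub>R H) within range (\<lambda>s::real. X + s *\<^sub>R H))"
      using has_derivative_subset[OF that sub] by simp
    from has_derivative_in_compose[OF line this] show ?thesis .
  qed
  have "(\<lambda>s. K \<bullet> (s *\<^sub>R H)) = (\<lambda>s. G \<bullet> (s *\<^sub>R H))"
    by (rule has_derivative_unique[OF * *]) (use K D in auto)
  then have "K \<bullet> (1 *\<^sub>R H) = G \<bullet> (1 *\<^sub>R H)" by meson
  then have "H \<bullet> H = 0" by (simp add: H_def inner_diff_left)
  then show "K = G" by (simp add: H_def)
qed

text \<open>The power \<open>a\<^sup>q\<close> with the convention \<open>0\<^sup>0 = 1\<close>, whereas \<open>0 powr 0 = 0\<close>.\<close>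

definition pow0 :: "real \<Rightarrow> real \<Rightarrow> real" where
  "pow0 a q = (if q = 0 then 1 else a powr q)"

definition joint_smooth ::
    "'a::euclidean_space set \<Rightarrow> ('a \<Rightarrow> real) \<Rightarrow> real \<Rightarrow> real \<Rightarrow> real \<Rightarrow> bool" where
  "joint_smooth S F L\<^sub>0 L\<^sub>1 q \<longleftrightarrow>
     (\<forall>X\<in>S. F differentiable (at X within S)) \<and>
     (\<forall>X\<in>S. \<forall>Y\<in>S. norm (grad S F X - grad S F Y)
        \<le> (L\<^sub>0 + L\<^sub>1 * pow0 (norm (grad S F X)) q) * norm (X - Y))"

text \<open>
  Unbiasedness and bounded variance of the stochastic gradient blocks for a sample with law \<open>D\<close>.
  The integrability clauses are part of the meaning of the expectations, because the Bochner
  integral of a non-integrable function is \<open>0\<close>.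
\<close>

definition layerwise_variance ::
    "(real^'m::finite^'n::finite^'l::finite) set \<Rightarrow> 'x measure \<Rightarrow> (real^'m^'n^'l \<Rightarrow> 'x \<Rightarrow> real)
      \<Rightarrow> (real^'m^'n^'l \<Rightarrow> real) \<Rightarrow> ('l \<Rightarrow> real) \<Rightarrow> bool" where
  "layerwise_variance S D f F \<sigma> \<longleftrightarrow>
     (\<forall>l. \<forall>X\<in>S.
        integrable D (\<lambda>x. grad S (\<lambda>Y. f Y x) X $ l) \<and>
        (\<integral>x. grad S (\<lambda>Y. f Y x) X $ l \<partial>D) = grad S F X $ l \<and>
        integrable D (\<lambda>x. (norm (grad S (\<lambda>Y. f Y x) X $ l - grad S F X $ l))\<^sup>2) \<and>
        (\<integral>x. (norm (grad S (\<lambda>Y. f Y x) X $ l - grad S F X $ l))\<^sup>2 \<partial>D) \<le> (\<sigma> l)\<^sup>2)"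

text \<open>
  The sum of the singular values, i.e. of the square roots of the eigenvalues of \<open>A\<^sup>T A\<close> counted
  with multiplicity.  As \<open>A\<^sup>T A\<close> is symmetric, the multiplicity is the dimension of the eigenspace.
\<close>

definition nuclear_norm :: "real^'m::finite^'n::finite \<Rightarrow> real" where
  "nuclear_norm A =
     (\<Sum>\<mu> \<in> {\<mu>. \<exists>v. v \<noteq> 0 \<and> (transpose A ** A) *v v = \<mu> *\<^sub>R v}.
        real (dim {v. (transpose A ** A) *v v = \<mu> *\<^sub>R v}) * sqrt \<mu>)"

text \<open>
  Matrices \<open>U\<close>, \<open>V\<close> with \<open>r\<close> columns, for a number \<open>r\<close> that is not fixed by the type, are given
  by their columns \<open>u i\<close>, \<open>v i\<close> for \<open>i < r\<close>.  Then \<open>U\<^sup>T U = 1\<close> says that the columns are orthonormal,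
  and \<open>U diag(s) V\<^sup>T\<close> has the entries below.
\<close>

definition orthonormal_columns :: "nat \<Rightarrow> (nat \<Rightarrow> real^'n::finite) \<Rightarrow> bool" where
  "orthonormal_columns r u \<longleftrightarrow> (\<forall>i<r. \<forall>j<r. u i \<bullet> u j = (if i = j then 1 else 0))"

definition U_diag_VT ::
    "nat \<Rightarrow> (nat \<Rightarrow> real^'n::finite) \<Rightarrow> (nat \<Rightarrow> real) \<Rightarrow> (nat \<Rightarrow> real^'m::finite) \<Rightarrow> real^'m^'n" where
  "U_diag_VT r u s v = (\<chi> a b. \<Sum>i<r. u i $ a * s i * v i $ b)"

definition compact_svd ::
    "real^'m::finite^'n::finite \<Rightarrow> nat \<Rightarrow> (nat \<Rightarrow> real^'n) \<Rightarrow> (nat \<Rightarrow> real) \<Rightarrow> (nat \<Rightarrow> real^'m) \<Rightarrow> bool"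
  where
  "compact_svd A r u s v \<longleftrightarrow>
     r = rank A \<and> orthonormal_columns r u \<and> orthonormal_columns r v \<and>
     (\<forall>i<r. 0 < s i) \<and> A = U_diag_VT r u s v"

text \<open>\<open>O'\<close> is an admissible output of the orthogonalization routine for the input \<open>N\<close>.\<close>

definition spectral_condition ::
    "real \<Rightarrow> real \<Rightarrow> real^'m::finite^'n::finite \<Rightarrow> real^'m^'n \<Rightarrow> bool" where
  "spectral_condition \<sigma>min \<sigma>max N O' \<longleftrightarrow>
     (N \<noteq> 0 \<longrightarrow>
        (\<exists>r u s v c. compact_svd N r u s v \<and> (\<forall>i<r. \<sigma>min \<le> c i \<and> c i \<le> \<sigma>max) \<and>
           O' = U_diag_VT r u c v)) \<and>
     (N = 0 \<longrightarrow> O' = 0)"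

text \<open>
  One trajectory of layer-wise Muon over the steps \<open>1..T\<close>, driven by the samples \<open>\<xi> t\<close>.  The routine
  \<open>orth t l\<close> may depend on the iteration and on the layer.
\<close>

definition layerwise_muon ::
    "(real^'m::finite^'n::finite^'l::finite) set \<Rightarrow> (real^'m^'n^'l \<Rightarrow> 'x \<Rightarrow> real)
      \<Rightarrow> (nat \<Rightarrow> 'l \<Rightarrow> real^'m^'n \<Rightarrow> real^'m^'n) \<Rightarrow> real \<Rightarrow> real \<Rightarrow> real \<Rightarrow> nat \<Rightarrow> real^'m^'n^'l
      \<Rightarrow> (nat \<Rightarrow> 'x) \<Rightarrow> (nat \<Rightarrow> real^'m^'n^'l) \<Rightarrow> (nat \<Rightarrow> real^'m^'n^'l) \<Rightarrow> (nat \<Rightarrow> real^'m^'n^'l)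
      \<Rightarrow> (nat \<Rightarrow> real^'m^'n^'l) \<Rightarrow> bool" where
  "layerwise_muon S f orth \<beta>\<^sub>1 \<beta>\<^sub>2 \<gamma> T X\<^sub>1 \<xi> X G M N \<longleftrightarrow>
     X 1 = X\<^sub>1 \<and> M 0 = 0 \<and>
     (\<forall>t\<in>{1..T}. \<forall>l.
        G t $ l = grad S (\<lambda>Y. f Y (\<xi> t)) (X t) $ l \<and>
        M t $ l = \<beta>\<^sub>1 *\<^sub>R M (t - 1) $ l + (1 - \<beta>\<^sub>1) *\<^sub>R G t $ l \<and>
        N t $ l = \<beta>\<^sub>2 *\<^sub>R M t $ l + (1 - \<beta>\<^sub>2) *\<^sub>R G t $ l \<and>
        X (t + 1) $ l = X t $ l - \<gamma> *\<^sub>R orth t l (N t $ l))"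

end

theory Submission
  imports Defs
begin

text \<open>
  Along a single trajectory, the descent lemma and the spectral condition bound the decrease of \<open>F\<close>
  by the nuclear norms of the gradient blocks, up to the errors \<open>N\<^sub>t - \<nabla>F(X\<^sub>t)\<close>.  Such an error splits
  into a bias \<open>\<beta>\<^sub>2 Z\<^sub>t\<close> and a noise \<open>W\<^sub>t\<close>: the bias contracts by the factor \<open>\<beta>\<^sub>1\<close> in every step and is
  fed only by the bounded drift of the gradient, while \<open>W\<^sub>t\<close> is a combination of martingale
  differences, so that its second moment is computed from orthogonality.  Only \<open>W\<^sub>t\<close> requires an
  expectation.  The gradients along the trajectory are uniformly bounded because the steps are,
  which gives integrability of the nuclear norms.

  If \<open>\<sigma>min > \<sigma>max\<close>, then the spectral condition forces every \<open>N\<^sub>t\<close> to vanish; the iterates are then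
  constant and stationary, and the inequality is trivial.
\<close>

section \<open>The nuclear norm\<close>

text \<open>Smoothness is joint, whereas noise and ranks are layerwise. The drift of the whole
  gradient is distributed over the layers by Cauchy-Schwarz, so that \<open>sqrt R\<^sub>0\<close>
  times a step of length \<open>\<gamma> * smax * sqrt R\<^sub>0\<close> yields
  \<open>R\<^sub>0\<close>; \<open>W\<close> is estimated in each layer separately. The local
  smoothness constant grows with the gradient. Young's inequality bounds it by \<open>Lhat\<close>
  plus \<open>q * L\<^sub>1\<close> times the gradient norm, hence times the nuclear norms. These
  occurrences move to the left side and form the two subtracted terms of \<open>\<Delta>\<close>:
  one half comes from the quadratic term of the descent lemma,
  \<open>2 / (1 - \<beta>\<^sub>1)\<close> from the summed drift. The probabilistic obstacle is
  measurability. The routine may depend on the outcome in any manner, so the path inequality is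
  proved for each outcome and, once \<open>F\<close> at the last iterate is replaced by
  \<open>Fstar\<close>, involves only gradients at \<open>X t\<close> and noise. Joint measurability
  of the stochastic gradient in point and sample comes from difference quotients, and conditioning
  on the past becomes Fubini on a product space.\<close>

text \<open>The Rayleigh quotient attains its maximum on the unit sphere of \<open>S\<close>, and a
  maximizer is an eigenvector; symmetry makes its orthogonal complement inside \<open>S\<close>
  invariant, which feeds the induction on the dimension.\<close>

lemma symmetric_eigenbasis_aux:
  fixes f :: "'a::euclidean_space \<Rightarrow> 'a"
  assumes f: "linear f" and sym: "\<And>x y. f x \<bullet> y = x \<bullet> f y"
  shows "subspace S \<Longrightarrow> f ` S \<subseteq> S \<Longrightarrow> dim S = n \<Longrightarrow>
    \<exists>B. B \<subseteq> S \<and> pairwise orthogonal B \<and> (\<forall>b\<in>B. norm b = 1 \<and> (\<exists>\<mu>. f b = \<mu> *\<^sub>R b)) \<and> span B = S"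
proof (induction n arbitrary: S)
  case 0
  then have "S = {0}" using dim_eq_0 subspace_0 by blast
  then show ?case by (intro exI[of _ "{}"]) auto
next
  case (Suc n)
  note S = Suc.prems(1) and inv = Suc.prems(2)
  define K where "K = S \<inter> sphere 0 1"
  obtain z where z: "z \<in> S" "z \<noteq> 0" using Suc.prems(3) by (metis Zero_not_Suc dim_eq_0 subsetI singleton_iff)
  then have "(1 / norm z) *\<^sub>R z \<in> K" unfolding K_def using S by (auto simp: subspace_scale)
  then have ne: "K \<noteq> {}" by auto
  have comp: "compact K" unfolding K_def by (simp add: closed_Int_compact closed_subspace S)
  have cont: "continuous_on K (\<lambda>x. x \<bullet> f x)"
    by (intro continuous_intros linear_continuous_on linear_conv_bounded_linear[THEN iffD1] f)
  obtain v where v: "v \<in> K" and vmax: "\<And>x. x \<in> K \<Longrightarrow> x \<bullet> f x \<le> v \<bullet> f v"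
    using continuous_attains_sup[OF comp ne cont] by blast
  define \<mu> where "\<mu> = v \<bullet> f v"
  have vS: "v \<in> S" and nv: "norm v = 1" using v by (auto simp: K_def)
  have vv: "v \<bullet> v = 1" using nv by (simp add: norm_eq_1)
  have Q: "x \<bullet> f x \<le> \<mu> * (x \<bullet> x)" if "x \<in> S" for x
  proof (cases "x = 0")
    case False
    then have "(1 / norm x) *\<^sub>R x \<in> K" using that S by (auto simp: K_def subspace_scale)
    from vmax[OF this] have "(x \<bullet> f x) / (norm x)^2 \<le> \<mu>"
      by (simp add: linear_cmul[OF f] \<mu>_def power2_eq_square)
    then show ?thesis using False by (simp add: divide_le_eq dot_square_norm)
  qed (use f in \<open>simp add: linear_0\<close>)
  \<comment> \<open>First variation at the maximizer \<open>v\<close> along the residual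
    \<open>w\<close>: the constant term of the quadratic in \<open>t\<close> cancels, so the linear
    coefficient \<open>2 * (w \<bullet> w)\<close> must vanish.\<close>
  define w where "w = \<mu> *\<^sub>R v - f v"
  have wS: "w \<in> S" unfolding w_def using S vS inv by (auto intro!: subspace_diff subspace_scale)
  define c where "c = \<mu> * (w \<bullet> w) - w \<bullet> f w"
  have lin: "0 \<le> 2 * t * (w \<bullet> w) + t\<^sup>2 * c" for t
  proof -
    have "v + t *\<^sub>R w \<in> S" using S vS wS by (simp add: subspace_add subspace_scale)
    from Q[OF this] have "0 \<le> \<mu> * ((v + t *\<^sub>R w) \<bullet> (v + t *\<^sub>R w)) - (v + t *\<^sub>R w) \<bullet> f (v + t *\<^sub>R w)" by simp
    also have "\<dots> = 2 * t * (w \<bullet> w) + t\<^sup>2 * c"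
    proof -
      have 1: "v \<bullet> f w = w \<bullet> f v" using sym[of v w] by (simp add: inner_commute)
      have "w \<bullet> w = w \<bullet> (\<mu> *\<^sub>R v - f v)" by (simp only: w_def)
      then have 2: "w \<bullet> w = \<mu> * (w \<bullet> v) - w \<bullet> f v" by (simp add: inner_diff_right)
      have "\<mu> * ((v + t *\<^sub>R w) \<bullet> (v + t *\<^sub>R w)) - (v + t *\<^sub>R w) \<bullet> f (v + t *\<^sub>R w)
          = 2 * t * (\<mu> * (w \<bullet> v) - w \<bullet> f v) + t\<^sup>2 * c"
        by (simp add: linear_add[OF f] linear_cmul[OF f] inner_add_left inner_add_right c_def
            power2_eq_square vv 1 \<mu>_def[symmetric] inner_commute[of v w] algebra_simps)
      then show ?thesis using 2 by simp
    qed
    finally show ?thesis .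
  qed
  have "w \<bullet> w = 0"
  proof (rule ccontr)
    assume "w \<bullet> w \<noteq> 0"
    then have p: "w \<bullet> w > 0" by (simp add: inner_gt_zero_iff)
    \<comment> \<open>Of the sign that makes the linear term negative, and so short that the
      quadratic term can compensate at most half of it.\<close>
    define t where "t = - (w \<bullet> w) / (\<bar>c\<bar> + 1)"
    have "t\<^sup>2 * c \<le> t\<^sup>2 * (\<bar>c\<bar> + 1)" by (intro mult_left_mono) auto
    also have "\<dots> = (w \<bullet> w)\<^sup>2 / (\<bar>c\<bar> + 1)"
      unfolding t_def by (simp add: power2_eq_square divide_simps)
    finally have "2 * t * (w \<bullet> w) + t\<^sup>2 * c \<le> - (w \<bullet> w)\<^sup>2 / (\<bar>c\<bar> + 1)"
      unfolding t_def by (simp add: power2_eq_square)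
    moreover have "(w \<bullet> w)\<^sup>2 / (\<bar>c\<bar> + 1) > 0" using p by simp
    ultimately show False using lin[of t] by simp
  qed
  then have fv: "f v = \<mu> *\<^sub>R v" by (simp add: w_def)
  define S' where "S' = S \<inter> {x. v \<bullet> x = 0}"
  have S': "subspace S'" unfolding S'_def by (intro subspace_inter S subspace_hyperplane)
  have inv': "f ` S' \<subseteq> S'"
  proof
    fix y assume "y \<in> f ` S'"
    then obtain x where x: "x \<in> S" "v \<bullet> x = 0" "y = f x" by (auto simp: S'_def)
    have "v \<bullet> f x = 0" using sym[of v x] fv x by simp
    then show "y \<in> S'" using x inv by (auto simp: S'_def)
  qed
  have span_ins: "span (insert v S') = S"
  proof
    show "span (insert v S') \<subseteq> S" using S vS by (intro span_minimal) (auto simp: S'_def)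
    show "S \<subseteq> span (insert v S')"
    proof
      fix x assume x: "x \<in> S"
      have "x - (v \<bullet> x) *\<^sub>R v \<in> S'"
        using x vS S vv by (auto simp: S'_def inner_diff_right intro!: subspace_diff subspace_scale)
      then have "(x - (v \<bullet> x) *\<^sub>R v) + (v \<bullet> x) *\<^sub>R v \<in> span (insert v S')"
        by (intro span_add span_scale span_base) auto
      then show "x \<in> span (insert v S')" by simp
    qed
  qed
  have "v \<notin> span S'" using vv unfolding span_eq_iff[THEN iffD2, OF S'] by (simp add: S'_def)
  then have "dim (insert v S') = Suc (dim S')" by (simp add: dim_insert)
  moreover have "dim (insert v S') = Suc n" using span_ins Suc.prems(3) by (metis dim_span)
  ultimately have "dim S' = n" by simp
  from Suc.IH[OF S' inv' this] obtain B where B: "B \<subseteq> S'" "pairwise orthogonal B"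
    "\<forall>b\<in>B. norm b = 1 \<and> (\<exists>\<mu>. f b = \<mu> *\<^sub>R b)" "span B = S'" by blast
  have "span (insert v B) = S"
    using span_ins unfolding B(4)[symmetric] by (simp add: span_insert span_span)
  moreover have "pairwise orthogonal (insert v B)"
    using B(1,2) by (auto simp: pairwise_insert S'_def orthogonal_def inner_commute)
  ultimately show ?case using B vS nv fv
    by (intro exI[of _ "insert v B"]) (auto simp: S'_def)
qed

definition onb :: "'a::euclidean_space set \<Rightarrow> bool" where
  "onb B \<longleftrightarrow> pairwise orthogonal B \<and> (\<forall>b\<in>B. norm b = 1) \<and> span B = UNIV"

lemma symmetric_eigenbasis:
  fixes f :: "'a::euclidean_space \<Rightarrow> 'a"
  assumes "linear f" and "\<And>x y. f x \<bullet> y = x \<bullet> f y"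
  obtains B where "onb B" and "\<And>b. b \<in> B \<Longrightarrow> \<exists>\<mu>. f b = \<mu> *\<^sub>R b"
  using symmetric_eigenbasis_aux[OF assms, of UNIV] unfolding onb_def by auto

lemma onb_independent: "onb B \<Longrightarrow> independent B"
  by (intro pairwise_orthogonal_independent) (auto simp: onb_def)

lemma onb_finite: "onb B \<Longrightarrow> finite B"
  using onb_independent independent_imp_finite by blast

lemma onb_inner: "onb B \<Longrightarrow> b \<in> B \<Longrightarrow> c \<in> B \<Longrightarrow> b \<bullet> c = (if b = c then 1 else 0)"
  unfolding onb_def by (auto simp: pairwise_def orthogonal_def norm_eq_1)

lemma onb_expand: "onb B \<Longrightarrow> (\<Sum>b\<in>B. (x \<bullet> b) *\<^sub>R b) = x"
  by (rule orthonormal_basis_expand) (use onb_finite in \<open>auto simp: onb_def\<close>)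

lemma onb_parseval: assumes "onb B" shows "(\<Sum>b\<in>B. (x \<bullet> b)\<^sup>2) = (norm x)\<^sup>2"
proof -
  have "x \<bullet> x = x \<bullet> (\<Sum>b\<in>B. (x \<bullet> b) *\<^sub>R b)" by (simp only: onb_expand[OF assms])
  also have "\<dots> = (\<Sum>b\<in>B. (x \<bullet> b)\<^sup>2)" by (simp add: inner_sum_right power2_eq_square)
  finally show ?thesis by (simp add: dot_square_norm)
qed

lemma matrix_inner_vector:
  fixes A :: "real^'m::finite^'n::finite"
  shows "(A *v x) \<bullet> y = x \<bullet> (transpose A *v y)"
  unfolding transpose_matrix_vector by (simp add: inner_commute[of x] dot_lmul_matrix inner_commute[of y])

lemma gram_inner:
  fixes A :: "real^'m::finite^'n::finite"
  shows "((transpose A ** A) *v x) \<bullet> y = (A *v x) \<bullet> (A *v y)"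
  using matrix_inner_vector[of A y "A *v x"] by (simp add: inner_commute matrix_vector_mul_assoc)

lemma gram_symmetric:
  fixes A :: "real^'m::finite^'n::finite"
  shows "((transpose A ** A) *v x) \<bullet> y = x \<bullet> ((transpose A ** A) *v y)"
  unfolding inner_commute[of x] gram_inner by (rule inner_commute)

section \<open>The nuclear norm through orthonormal bases, and its dual form\<close>

text \<open>An orthonormal eigenbasis of the Gram matrix contains a basis of each eigenspace, so the
  multiplicity in the definition counts basis vectors. The eigenvalue at \<open>b\<close> is the
  squared length of \<open>A *v b\<close>, as it is the inner product of \<open>b\<close> with its
  image under the Gram matrix.\<close>

lemma nuclear_norm_eigenbasis:
  fixes A :: "real^'m::finite^'n::finite"
  assumes B: "onb B" and eig: "\<And>b. b \<in> B \<Longrightarrow> \<exists>\<mu>. (transpose A ** A) *v b = \<mu> *\<^sub>R b"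
  shows "nuclear_norm A = (\<Sum>b\<in>B. norm (A *v b))"
proof -
  define H where "H = transpose A ** A"
  define m where "m b = (norm (A *v b))\<^sup>2" for b
  have fin: "finite B" using B by (rule onb_finite)
  have Hb: "H *v b = m b *\<^sub>R b" if b: "b \<in> B" for b
  proof -
    obtain \<mu> where \<mu>: "H *v b = \<mu> *\<^sub>R b" using eig[OF b] unfolding H_def by blast
    have "m b = (H *v b) \<bullet> b" unfolding H_def gram_inner m_def by (simp add: dot_square_norm)
    also have "\<dots> = \<mu>" using \<mu> onb_inner[OF B b b] by simp
    finally show ?thesis using \<mu> by simp
  qed
  have coord: "(H *v v) \<bullet> b = m b * (v \<bullet> b)" if "b \<in> B" for b v
    using Hb[OF that] gram_symmetric[of A v b] by (simp add: H_def)
  \<comment> \<open>Comparison of coordinates: for an eigenvector with eigenvalue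
    \<open>\<mu>\<close>, symmetry forces the coordinate at every \<open>b\<close> with
    \<open>m b \<noteq> \<mu>\<close> to be zero.\<close>
  have E: "{v. H *v v = \<mu> *\<^sub>R v} = span {b\<in>B. m b = \<mu>}" for \<mu>
  proof
    show "span {b\<in>B. m b = \<mu>} \<subseteq> {v. H *v v = \<mu> *\<^sub>R v}"
    proof (rule span_minimal)
      show "subspace {v. H *v v = \<mu> *\<^sub>R v}"
        by (auto simp: subspace_def matrix_vector_right_distrib matrix_vector_mult_scaleR algebra_simps)
    qed (use Hb in auto)
    show "{v. H *v v = \<mu> *\<^sub>R v} \<subseteq> span {b\<in>B. m b = \<mu>}"
    proof
      fix v assume "v \<in> {v. H *v v = \<mu> *\<^sub>R v}"
      then have "m b * (v \<bullet> b) = \<mu> * (v \<bullet> b)" if "b \<in> B" for b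
        using coord[OF that, of v] by auto
      then have z: "v \<bullet> b = 0" if "b \<in> B" "m b \<noteq> \<mu>" for b using that by force
      have "v = (\<Sum>b\<in>B. (v \<bullet> b) *\<^sub>R b)" by (simp add: onb_expand[OF B])
      also have "\<dots> = (\<Sum>b\<in>{b\<in>B. m b = \<mu>}. (v \<bullet> b) *\<^sub>R b)"
        using z fin by (intro sum.mono_neutral_right) auto
      also have "\<dots> \<in> span {b\<in>B. m b = \<mu>}"
        by (intro span_sum span_scale span_base) auto
      finally show "v \<in> span {b\<in>B. m b = \<mu>}" .
    qed
  qed
  have ev: "{\<mu>. \<exists>v. v \<noteq> 0 \<and> H *v v = \<mu> *\<^sub>R v} = m ` B"
  proof (intro equalityI subsetI)
    fix \<mu> assume "\<mu> \<in> {\<mu>. \<exists>v. v \<noteq> 0 \<and> H *v v = \<mu> *\<^sub>R v}"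
    then obtain v where "v \<noteq> 0" "v \<in> span {b\<in>B. m b = \<mu>}" using E by blast
    then have "{b\<in>B. m b = \<mu>} \<noteq> {}" by (metis singletonD span_empty)
    then show "\<mu> \<in> m ` B" by auto
  next
    fix \<mu> assume "\<mu> \<in> m ` B"
    then obtain b where b: "b \<in> B" "\<mu> = m b" by auto
    moreover have "b \<noteq> 0" using onb_inner[OF B b(1) b(1)] by auto
    ultimately show "\<mu> \<in> {\<mu>. \<exists>v. v \<noteq> 0 \<and> H *v v = \<mu> *\<^sub>R v}" using Hb[OF b(1)] by blast
  qed
  have dimE: "dim {v. H *v v = \<mu> *\<^sub>R v} = card {b\<in>B. m b = \<mu>}" for \<mu>
    unfolding E dim_span using independent_mono[OF onb_independent[OF B]]
    by (intro dim_eq_card_independent) auto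
  have "nuclear_norm A = (\<Sum>\<mu>\<in>m ` B. real (card {b\<in>B. m b = \<mu>}) * sqrt \<mu>)"
    unfolding nuclear_norm_def H_def[symmetric] ev dimE ..
  also have "\<dots> = (\<Sum>\<mu>\<in>m ` B. \<Sum>b\<in>{b\<in>B. m b = \<mu>}. sqrt (m b))"
    by (intro sum.cong refl) (simp add: sum_constant_scaleR)
  also have "\<dots> = (\<Sum>b\<in>B. sqrt (m b))"
    using sum.image_gen[OF fin, of "\<lambda>b. sqrt (m b)" m] by simp
  finally show ?thesis by (simp add: m_def)
qed

text \<open>The basis consists of right singular vectors. Their images are singular values times
  left singular vectors, hence orthogonal and possibly zero.\<close>

lemma nuclear_norm_attained:
  fixes A :: "real^'m::finite^'n::finite"
  obtains B where "onb B" "pairwise (\<lambda>b c. orthogonal (A *v b) (A *v c)) B"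
    "nuclear_norm A = (\<Sum>b\<in>B. norm (A *v b))"
proof -
  define H where "H = transpose A ** A"
  obtain B where B: "onb B" "\<And>b. b \<in> B \<Longrightarrow> \<exists>\<mu>. H *v b = \<mu> *\<^sub>R b"
    by (rule symmetric_eigenbasis[of "\<lambda>v. H *v v"]) (auto simp: H_def gram_symmetric)
  have "pairwise (\<lambda>b c. orthogonal (A *v b) (A *v c)) B"
  proof (rule pairwiseI)
    fix b c assume bc: "b \<in> B" "c \<in> B" "b \<noteq> c"
    then obtain \<mu> where "H *v b = \<mu> *\<^sub>R b" using B(2) by blast
    then have "(A *v b) \<bullet> (A *v c) = \<mu> * (b \<bullet> c)" using gram_inner[of A b c] by (simp add: H_def)
    then show "orthogonal (A *v b) (A *v c)" using onb_inner[OF B(1), of b c] bc by (simp add: orthogonal_def)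
  qed
  then show thesis using that B nuclear_norm_eigenbasis[OF B(1), of A] unfolding H_def by blast
qed

text \<open>Easy half of trace duality. Let K be the linear map sending each \<open>b\<close> to
  \<open>y b\<close>. The left side is the trace of \<open>transpose A\<close> times K, which may be
  computed in the basis \<open>C\<close> instead, and K is a contraction because the
  \<open>y b\<close> are orthogonal and of length at most one.\<close>

lemma sum_inner_le_sum_norm:
  fixes A :: "real^'m::finite^'n::finite"
  assumes B: "onb B" and C: "onb C"
    and y: "pairwise (\<lambda>b c. orthogonal (y b) (y c)) B" "\<And>b. b \<in> B \<Longrightarrow> norm (y b) \<le> 1"
  shows "(\<Sum>b\<in>B. (A *v b) \<bullet> y b) \<le> (\<Sum>c\<in>C. norm (A *v c))"
proof -
  have "(\<Sum>b\<in>B. (A *v b) \<bullet> y b) = (\<Sum>b\<in>B. \<Sum>c\<in>C. (b \<bullet> c) * ((A *v c) \<bullet> y b))"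
  proof (rule sum.cong[OF refl])
    fix b
    have "A *v b = A *v (\<Sum>c\<in>C. (b \<bullet> c) *\<^sub>R c)" by (simp only: onb_expand[OF C])
    also have "\<dots> = (\<Sum>c\<in>C. (b \<bullet> c) *\<^sub>R (A *v c))"
      by (simp add: linear_sum[OF matrix_vector_mul_linear] matrix_vector_mult_scaleR)
    finally show "(A *v b) \<bullet> y b = (\<Sum>c\<in>C. (b \<bullet> c) * ((A *v c) \<bullet> y b))"
      by (simp add: inner_sum_left)
  qed
  also have "\<dots> = (\<Sum>c\<in>C. (A *v c) \<bullet> (\<Sum>b\<in>B. (b \<bullet> c) *\<^sub>R y b))"
    by (subst sum.swap) (simp add: inner_sum_right)
  also have "\<dots> \<le> (\<Sum>c\<in>C. norm (A *v c))"
  proof (rule sum_mono)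
    fix c assume c: "c \<in> C"
    \<comment> \<open>The vector is the image of \<open>c\<close> under the contraction: Pythagoras
      for the \<open>y b\<close>, then Parseval for \<open>c\<close> in the basis
      \<open>B\<close>.\<close>
    have "(norm (\<Sum>b\<in>B. (b \<bullet> c) *\<^sub>R y b))\<^sup>2 = (\<Sum>b\<in>B. (norm ((b \<bullet> c) *\<^sub>R y b))\<^sup>2)"
      using y(1) by (intro norm_sum_Pythagorean onb_finite[OF B]) (auto simp: pairwise_def orthogonal_def)
    also have "\<dots> \<le> (\<Sum>b\<in>B. (c \<bullet> b)\<^sup>2)"
    proof (rule sum_mono)
      fix b assume "b \<in> B"
      then have "(norm (y b))\<^sup>2 \<le> 1" using y(2) by (simp add: power_le_one)
      then show "(norm ((b \<bullet> c) *\<^sub>R y b))\<^sup>2 \<le> (c \<bullet> b)\<^sup>2"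
        by (simp add: power_mult_distrib inner_commute mult_left_le)
    qed
    also have "\<dots> = 1" using onb_parseval[OF B, of c] C c by (simp add: onb_def)
    finally have "norm (\<Sum>b\<in>B. (b \<bullet> c) *\<^sub>R y b) \<le> 1" by (simp add: abs_square_le_1)
    then show "(A *v c) \<bullet> (\<Sum>b\<in>B. (b \<bullet> c) *\<^sub>R y b) \<le> norm (A *v c)"
      by (meson Cauchy_Schwarz_ineq2 abs_le_D1 mult_left_le norm_ge_zero order_trans)
  qed
  finally show ?thesis .
qed

text \<open>Equality in this duality, with \<open>y b\<close> the normalized image of a right
  singular vector. Since \<open>sgn\<close> maps zero to zero, lengths are only bounded by
  one.\<close>

lemma nuclear_norm_dual:
  fixes A :: "real^'m::finite^'n::finite"
  obtains B y where "onb B" "pairwise (\<lambda>b c. orthogonal (y b) (y c)) B" "\<forall>b\<in>B. norm (y b) \<le> 1"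
    "nuclear_norm A = (\<Sum>b\<in>B. (A *v b) \<bullet> y b)"
proof -
  obtain B where B: "onb B" "pairwise (\<lambda>b c. orthogonal (A *v b) (A *v c)) B"
    "nuclear_norm A = (\<Sum>b\<in>B. norm (A *v b))" by (rule nuclear_norm_attained)
  show thesis
    by (rule that[of B "\<lambda>b. sgn (A *v b)"])
       (use B in \<open>auto simp: sgn_div_norm norm_sgn pairwise_def orthogonal_def power2_norm_eq_inner[symmetric]
          power2_eq_square divide_simps intro!: sum.cong\<close>)
qed

lemma nuclear_norm_le_sum_norm: "onb C \<Longrightarrow> nuclear_norm A \<le> (\<Sum>c\<in>C. norm (A *v c))"
  by (rule nuclear_norm_dual[of A]) (use sum_inner_le_sum_norm in fastforce)

text \<open>For a fixed test family \<open>y\<close> the dual pairing is linear in the matrix, so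
  the value at the sum splits at its own optimal family, and duality bounds each part.\<close>

lemma nuclear_norm_triangle: "nuclear_norm (A + B) \<le> nuclear_norm A + nuclear_norm B"
proof -
  obtain C y where C: "onb C" "pairwise (\<lambda>b c. orthogonal (y b) (y c)) C" "\<forall>b\<in>C. norm (y b) \<le> 1"
    "nuclear_norm (A + B) = (\<Sum>b\<in>C. ((A + B) *v b) \<bullet> y b)" by (rule nuclear_norm_dual[of "A + B"])
  have "nuclear_norm (A + B) = (\<Sum>b\<in>C. (A *v b) \<bullet> y b) + (\<Sum>b\<in>C. (B *v b) \<bullet> y b)"
    unfolding C(4) by (simp add: matrix_vector_mult_add_rdistrib inner_add_left sum.distrib)
  moreover have le: "(\<Sum>b\<in>C. (D *v b) \<bullet> y b) \<le> nuclear_norm D" for D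
    by (rule nuclear_norm_attained[of D]) (use C(1-3) sum_inner_le_sum_norm in fastforce)
  ultimately show ?thesis using le[of A] le[of B] by linarith
qed

lemma nuclear_norm_nonneg: "0 \<le> nuclear_norm A"
  by (metis nuclear_norm_attained norm_ge_zero sum_nonneg)

lemma frobenius_onb:
  fixes A :: "real^'m::finite^'n::finite"
  assumes B: "onb B" shows "(norm A)\<^sup>2 = (\<Sum>b\<in>B. (norm (A *v b))\<^sup>2)"
proof -
  have nv: "(norm x)\<^sup>2 = (\<Sum>i\<in>UNIV. (norm (x $ i))\<^sup>2)" for x :: "'b::real_inner^'c::finite"
    by (simp add: power2_norm_eq_inner inner_vec_def)
  have "(norm A)\<^sup>2 = (\<Sum>i\<in>UNIV. \<Sum>b\<in>B. (A $ i \<bullet> b)\<^sup>2)"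
    by (simp add: nv[of A] onb_parseval[OF B])
  also have "\<dots> = (\<Sum>b\<in>B. (norm (A *v b))\<^sup>2)"
    by (subst sum.swap) (simp add: nv matrix_vector_mul_component)
  finally show ?thesis .
qed

lemma frobenius_le_nuclear_norm: "norm A \<le> nuclear_norm A"
proof -
  obtain B where B: "onb B" "nuclear_norm A = (\<Sum>b\<in>B. norm (A *v b))" by (metis nuclear_norm_attained)
  have "norm A = L2_set (\<lambda>b. norm (A *v b)) B"
    unfolding L2_set_def frobenius_onb[OF B(1), symmetric] by simp
  also have "\<dots> \<le> (\<Sum>b\<in>B. norm (A *v b))" by (intro L2_set_le_sum) auto
  finally show ?thesis using B(2) by simp
qed

lemma sum_le_sqrt_card_L2_set:
  assumes "finite B" shows "(\<Sum>b\<in>B. f b) \<le> sqrt (real (card B)) * L2_set f B"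
proof -
  have "(\<Sum>b\<in>B. f b) \<le> (\<Sum>b\<in>B. \<bar>1\<bar> * \<bar>f b\<bar>)" by (intro sum_mono) auto
  also have "\<dots> \<le> L2_set (\<lambda>_. 1) B * L2_set f B" by (rule L2_set_mult_ineq)
  finally show ?thesis by (simp add: L2_set_def)
qed

text \<open>Cauchy-Schwarz over the nonzero singular values. Their number is at most the rank,
  because the corresponding images are nonzero, pairwise orthogonal vectors in the range.\<close>

lemma nuclear_norm_le_frobenius:
  fixes A :: "real^'m::finite^'n::finite"
  shows "nuclear_norm A \<le> sqrt (real (rank A)) * norm A"
proof -
  obtain B where B: "onb B" "pairwise (\<lambda>b c. orthogonal (A *v b) (A *v c)) B"
    "nuclear_norm A = (\<Sum>b\<in>B. norm (A *v b))" by (rule nuclear_norm_attained)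
  define C where "C = {b\<in>B. A *v b \<noteq> 0}"
  have finC: "finite C" using onb_finite[OF B(1)] by (simp add: C_def)
  have inj: "inj_on (\<lambda>b. A *v b) C"
  proof (rule inj_onI)
    fix b c assume "b \<in> C" "c \<in> C" "A *v b = A *v c"
    then show "b = c" using B(2) unfolding C_def pairwise_def orthogonal_def
      by (metis (mono_tags, lifting) inner_eq_zero_iff mem_Collect_eq)
  qed
  have "independent ((\<lambda>b. A *v b) ` C)"
    using B(2) by (intro pairwise_orthogonal_independent) (auto simp: C_def pairwise_def)
  then have "card ((\<lambda>b. A *v b) ` C) \<le> dim (range (\<lambda>b. A *v b))"
    by (intro independent_card_le_dim) auto
  then have card: "card C \<le> rank A" by (simp add: card_image[OF inj] rank_dim_range)
  have "nuclear_norm A = (\<Sum>b\<in>C. norm (A *v b))"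
    unfolding B(3) C_def using onb_finite[OF B(1)] by (intro sum.mono_neutral_right) auto
  also have "\<dots> \<le> sqrt (real (card C)) * L2_set (\<lambda>b. norm (A *v b)) C"
    by (rule sum_le_sqrt_card_L2_set[OF finC])
  also have "L2_set (\<lambda>b. norm (A *v b)) C = norm A"
  proof -
    have "(\<Sum>b\<in>C. (norm (A *v b))\<^sup>2) = (\<Sum>b\<in>B. (norm (A *v b))\<^sup>2)"
      unfolding C_def using onb_finite[OF B(1)] by (intro sum.mono_neutral_left) auto
    then show ?thesis by (simp add: L2_set_def frobenius_onb[OF B(1), symmetric])
  qed
  also have "sqrt (real (card C)) * norm A \<le> sqrt (real (rank A)) * norm A"
    using card by (intro mult_right_mono) auto
  finally show ?thesis .
qed

text \<open>Serves the Borel measurability of the random nuclear norms. The Lipschitz constant comes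
  from the triangle inequality and the bound of the rank by the number of columns.\<close>

lemma continuous_nuclear_norm: "continuous_on UNIV (nuclear_norm :: real^'m::finite^'n::finite \<Rightarrow> real)"
proof -
  have 1: "nuclear_norm A - nuclear_norm B \<le> sqrt (real CARD('m)) * dist A B" for A B :: "real^'m^'n"
  proof -
    have "nuclear_norm A \<le> nuclear_norm B + nuclear_norm (A - B)"
      using nuclear_norm_triangle[of B "A - B"] by simp
    moreover have "nuclear_norm (A - B) \<le> sqrt (real (rank (A - B))) * norm (A - B)"
      by (rule nuclear_norm_le_frobenius)
    moreover have "\<dots> \<le> sqrt (real CARD('m)) * norm (A - B)"
      using rank_bound[of "A - B"] by (intro mult_right_mono) auto
    ultimately show ?thesis by (simp add: dist_norm)
  qed
  have "(sqrt (real CARD('m)))-lipschitz_on UNIV (nuclear_norm :: real^'m^'n \<Rightarrow> real)"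
  proof (rule lipschitz_onI)
    fix A B :: "real^'m^'n"
    show "dist (nuclear_norm A) (nuclear_norm B) \<le> sqrt (real CARD('m)) * dist A B"
      using 1[of A B] 1[of B A] by (simp add: dist_real_def dist_commute abs_le_iff)
  qed simp
  then show ?thesis by (rule lipschitz_on_continuous_on)
qed

section \<open>Matrices assembled from singular vectors\<close>

lemma U_diag_VT_row: "U_diag_VT k u s v $ a = (\<Sum>i<k. (u i $ a * s i) *\<^sub>R v i)"
  by (simp add: vec_eq_iff U_diag_VT_def)

lemma U_diag_VT_mult_vector: "U_diag_VT k u s v *v x = (\<Sum>i<k. (s i * (v i \<bullet> x)) *\<^sub>R u i)"
  by (simp add: vec_eq_iff matrix_vector_mul_component U_diag_VT_row inner_sum_left mult_ac)

text \<open>The rank-one matrices formed from \<open>u i\<close> and \<open>v i\<close> are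
  orthonormal, since the Frobenius inner product factors on rank-one matrices.\<close>

lemma inner_U_diag_VT:
  assumes "orthonormal_columns k u" "orthonormal_columns k v"
  shows "U_diag_VT k u s v \<bullet> U_diag_VT k u c v = (\<Sum>i<k. s i * c i)"
proof -
  have sum1: "U_diag_VT k u s v = (\<Sum>i<k. s i *\<^sub>R (\<chi> a. u i $ a *\<^sub>R v i))" for s
    by (simp add: vec_eq_iff U_diag_VT_def mult_ac)
  have inner1: "(\<chi> a. x $ a *\<^sub>R y) \<bullet> (\<chi> a. x' $ a *\<^sub>R y') = (x \<bullet> x') * (y \<bullet> y')"
    for x x' :: "real^'a" and y y' :: "real^'b"
    by (simp add: inner_vec_def[of "\<chi> a. x $ a *\<^sub>R y"] inner_vec_def[of x] sum_distrib_left mult_ac)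
  have "U_diag_VT k u s v \<bullet> U_diag_VT k u c v
      = (\<Sum>i<k. \<Sum>j<k. s i * c j * ((u i \<bullet> u j) * (v i \<bullet> v j)))"
    unfolding sum1 inner_sum_left inner_sum_right by (simp add: inner1 mult_ac) (rule sum.swap)
  also have "\<dots> = (\<Sum>i<k. \<Sum>j<k. if i = j then s i * c j else 0)"
    using assms by (intro sum.cong refl) (auto simp: orthonormal_columns_def)
  finally show ?thesis by simp
qed

text \<open>Testing with a dual family produces \<open>s i\<close> times the inner product of the
  unit vector \<open>u i\<close> with the image of the unit vector \<open>v i\<close> under a
  contraction. Duality avoids identifying the eigenspaces of the Gram matrix from the given
  factors.\<close>

lemma nuclear_norm_U_diag_VT_le:
  assumes u: "orthonormal_columns k u" and v: "orthonormal_columns k v" and s: "\<And>i. i < k \<Longrightarrow> 0 \<le> s i"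
  shows "nuclear_norm (U_diag_VT k u s v) \<le> (\<Sum>i<k. s i)"
proof -
  obtain B y where B: "onb B" "pairwise (\<lambda>b c. orthogonal (y b) (y c)) B" "\<forall>b\<in>B. norm (y b) \<le> 1"
    "nuclear_norm (U_diag_VT k u s v) = (\<Sum>b\<in>B. (U_diag_VT k u s v *v b) \<bullet> y b)"
    by (rule nuclear_norm_dual[of "U_diag_VT k u s v"])
  have "nuclear_norm (U_diag_VT k u s v) = (\<Sum>i<k. s i * (u i \<bullet> (\<Sum>b\<in>B. (v i \<bullet> b) *\<^sub>R y b)))"
    unfolding B(4) U_diag_VT_mult_vector inner_sum_left inner_sum_right sum_distrib_left
    by (subst sum.swap) (simp add: algebra_simps)
  also have "\<dots> \<le> (\<Sum>i<k. s i)"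
  proof (rule sum_mono)
    fix i assume i: "i \<in> {..<k}"
    have nu: "norm (u i) = 1" and nv: "norm (v i) = 1"
      using u v i by (auto simp: orthonormal_columns_def norm_eq_1)
    have "(norm (\<Sum>b\<in>B. (v i \<bullet> b) *\<^sub>R y b))\<^sup>2 = (\<Sum>b\<in>B. (norm ((v i \<bullet> b) *\<^sub>R y b))\<^sup>2)"
      using B(2) by (intro norm_sum_Pythagorean onb_finite[OF B(1)]) (auto simp: pairwise_def orthogonal_def)
    also have "\<dots> \<le> (\<Sum>b\<in>B. (v i \<bullet> b)\<^sup>2)"
      by (intro sum_mono) (simp add: power_mult_distrib B(3)[rule_format] power_le_one mult_left_le)
    also have "\<dots> = 1" using onb_parseval[OF B(1), of "v i"] nv by simp
    finally have "norm (\<Sum>b\<in>B. (v i \<bullet> b) *\<^sub>R y b) \<le> 1" by (simp add: abs_square_le_1)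
    then have "u i \<bullet> (\<Sum>b\<in>B. (v i \<bullet> b) *\<^sub>R y b) \<le> 1"
      by (metis nu mult_1 norm_cauchy_schwarz order_trans)
    then show "s i * (u i \<bullet> (\<Sum>b\<in>B. (v i \<bullet> b) *\<^sub>R y b)) \<le> s i"
      using s i by (simp add: mult_left_le)
  qed
  finally show ?thesis .
qed

section \<open>Gradients relative to a subspace\<close>

text \<open>The Riesz vector of a derivative within \<open>S\<close> need not lie in
  \<open>S\<close>. Its orthogonal projection onto \<open>S\<close> does, and represents the same
  functional on \<open>S\<close>.\<close>

lemma grad_props:
  fixes S :: "'a::euclidean_space set"
  assumes S: "subspace S" and X: "X \<in> S" and h: "h differentiable (at X within S)"
  shows "grad S h X \<in> S" and "(h has_derivative (\<lambda>H. grad S h X \<bullet> H)) (at X within S)"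
proof -
  obtain h' where h': "(h has_derivative h') (at X within S)" using h by (auto simp: differentiable_def)
  then have lin: "linear h'" by (simp add: has_derivative_linear)
  define g where "g = (\<Sum>b\<in>Basis. h' b *\<^sub>R b)"
  have g: "h' x = g \<bullet> x" for x
  proof -
    have "h' x = h' (\<Sum>b\<in>Basis. (x \<bullet> b) *\<^sub>R b)" by (simp add: euclidean_representation)
    also have "\<dots> = g \<bullet> x"
      by (simp add: linear_sum[OF lin] linear_cmul[OF lin] g_def inner_sum_left inner_commute[of x] mult.commute)
    finally show ?thesis .
  qed
  obtain y z where yz: "y \<in> span S" "\<And>w. w \<in> span S \<Longrightarrow> orthogonal z w" "g = y + z"
    using orthogonal_subspace_decomp_exists[of S g] by metis
  have sp: "span S = S" using S by simp
  have eq: "h' x = y \<bullet> x" if "x \<in> S" for x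
    using yz(2)[of x] yz(3) that g sp by (simp add: inner_add_left orthogonal_def)
  \<comment> \<open>Only increments \<open>w - X\<close> in \<open>S\<close> enter the difference
    quotient, and there \<open>h'\<close> agrees with the pairing with \<open>y\<close>.\<close>
  have "(h has_derivative (\<lambda>H. y \<bullet> H)) (at X within S)"
    unfolding has_derivative_within
  proof (intro conjI bounded_linear_inner_right)
    have "((\<lambda>w. (1 / norm (w - X)) *\<^sub>R (h w - (h X + h' (w - X)))) \<longlongrightarrow> 0) (at X within S)"
      using h' by (simp add: has_derivative_within)
    then show "((\<lambda>w. (1 / norm (w - X)) *\<^sub>R (h w - (h X + y \<bullet> (w - X)))) \<longlongrightarrow> 0) (at X within S)"
      by (rule Lim_transform_eventually)
         (use X S in \<open>auto simp: eventually_at_filter eq subspace_diff\<close>)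
  qed
  then have D: "y \<in> S \<and> (h has_derivative (\<lambda>H. y \<bullet> H)) (at X within S)" using yz sp by auto
  then have "grad S h X = y" using grad_eqI[OF S X] by blast
  then show "grad S h X \<in> S" "(h has_derivative (\<lambda>H. grad S h X \<bullet> H)) (at X within S)"
    using D by auto
qed

lemma has_derivative_along_line:
  assumes S: "subspace S" and X: "X \<in> S" and d: "d \<in> S"
    and D: "\<And>Y. Y \<in> S \<Longrightarrow> (h has_derivative (\<lambda>H. g Y \<bullet> H)) (at Y within S)"
  shows "((\<lambda>s. h (X + s *\<^sub>R d)) has_real_derivative g (X + s *\<^sub>R d) \<bullet> d) (at s)"
proof -
  have line: "((\<lambda>s::real. X + s *\<^sub>R d) has_derivative (\<lambda>s. s *\<^sub>R d)) (at s)"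
    by (auto intro!: derivative_eq_intros)
  have sub: "range (\<lambda>s::real. X + s *\<^sub>R d) \<subseteq> S"
    using S X d by (auto simp: subspace_add subspace_scale)
  have "(h has_derivative (\<lambda>H. g (X + s *\<^sub>R d) \<bullet> H))
      (at (X + s *\<^sub>R d) within range (\<lambda>s::real. X + s *\<^sub>R d))"
    using has_derivative_subset[OF D sub] sub by blast
  from has_derivative_in_compose[OF line this] show ?thesis
    by (simp add: has_field_derivative_def mult_commute_abs)
qed

text \<open>A sequence of function values, rather than a limit over all real steps, is the form
  through which measurability in the sample passes to the gradient.\<close>

lemma grad_difference_quotient:
  fixes S :: "'a::euclidean_space set"
  assumes S: "subspace S" and X: "X \<in> S" and d: "d \<in> S"
    and D: "\<And>Y. Y \<in> S \<Longrightarrow> h differentiable (at Y within S)"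
  shows "(\<lambda>n. (h (X + (1 / real (Suc n)) *\<^sub>R d) - h X) * real (Suc n)) \<longlonglongrightarrow> grad S h X \<bullet> d"
proof -
  have "((\<lambda>s. h (X + s *\<^sub>R d)) has_real_derivative grad S h (X + 0 *\<^sub>R d) \<bullet> d) (at 0)"
    by (rule has_derivative_along_line[OF S X d]) (rule grad_props[OF S _ D])
  then have "((\<lambda>s. (h (X + s *\<^sub>R d) - h X) / s) \<longlongrightarrow> grad S h X \<bullet> d) (at 0)"
    by (simp add: DERIV_def)
  then have "(\<lambda>n. (h (X + (1 / real (Suc n)) *\<^sub>R d) - h X) / (1 / real (Suc n))) \<longlonglongrightarrow> grad S h X \<bullet> d"
    by (rule filterlim_compose)
       (auto simp: filterlim_at intro!: LIMSEQ_inverse_real_of_nat simp: divide_inverse simp del: of_nat_Suc)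
  then show ?thesis by simp
qed

section \<open>Consequences of joint smoothness\<close>

text \<open>Weighted arithmetic-geometric mean of \<open>a\<close> and \<open>1\<close>. The summand
  \<open>1 - q\<close> is what later enters \<open>Lhat\<close>.\<close>

lemma pow0_le: "0 \<le> a \<Longrightarrow> 0 \<le> q \<Longrightarrow> q \<le> 1 \<Longrightarrow> pow0 a q \<le> q * a + (1 - q)"
proof (cases "q = 0 \<or> a = 0")
  case False
  assume "0 \<le> a" "0 \<le> q" "q \<le> 1"
  with False have a: "0 < a" "0 \<le> q" "q \<le> 1" by auto
  have "a powr q * 1 powr (1 - q) \<le> q * a + (1 - q) * 1"
    by (rule Youngs_inequality_0) (use a in auto)
  then show ?thesis using False by (simp add: pow0_def)
qed (auto simp: pow0_def)

lemma smoothness_constant_le: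
  assumes "0 \<le> L\<^sub>1" "0 \<le> q" "q \<le> 1" "0 \<le> a"
  shows "L\<^sub>0 + L\<^sub>1 * pow0 a q \<le> (L\<^sub>0 + (1 - q) * L\<^sub>1) + q * L\<^sub>1 * a"
  using mult_left_mono[OF pow0_le[OF assms(4,2,3)] assms(1)] by (simp add: algebra_simps)

text \<open>The usual descent argument with the constant frozen at \<open>X\<close>: the smoothness
  bound depends on the gradient at its first argument only, and every point of the segment is
  compared with \<open>X\<close>.\<close>

lemma smooth_descent:
  fixes S :: "'a::euclidean_space set"
  assumes S: "subspace S" and sm: "joint_smooth S F L\<^sub>0 L\<^sub>1 q" and X: "X \<in> S" and Y: "Y \<in> S"
  shows "F Y \<le> F X + grad S F X \<bullet> (Y - X) + (L\<^sub>0 + L\<^sub>1 * pow0 (norm (grad S F X)) q) / 2 * (norm (Y - X))\<^sup>2"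
proof -
  define K where "K = L\<^sub>0 + L\<^sub>1 * pow0 (norm (grad S F X)) q"
  define d where "d = Y - X"
  have d: "d \<in> S" using S X Y by (simp add: d_def subspace_diff)
  \<comment> \<open>\<open>F\<close> along the segment minus the nonconstant part of the claimed
    upper bound, so the assertion is that this function does not increase from 0 to 1.\<close>
  define \<phi> where "\<phi> s = F (X + s *\<^sub>R d) - s * (grad S F X \<bullet> d) - K / 2 * s\<^sup>2 * (norm d)\<^sup>2" for s
  have diff: "F differentiable (at Z within S)" if "Z \<in> S" for Z
    using sm that by (simp add: joint_smooth_def)
  have der: "(\<phi> has_real_derivative (grad S F (X + s *\<^sub>R d) \<bullet> d - grad S F X \<bullet> d - K * s * (norm d)\<^sup>2)) (at s)" for s
    unfolding \<phi>_def
    by (rule derivative_eq_intros has_derivative_along_line[OF S X d] grad_props[OF S _ diff] refl | assumption)+ simp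
  have "\<phi> 1 \<le> \<phi> 0"
  proof (rule DERIV_nonpos_imp_nonincreasing[where f = \<phi>])
    fix s :: real assume s: "0 \<le> s" "s \<le> 1"
    have Z: "X + s *\<^sub>R d \<in> S" using S X d by (simp add: subspace_add subspace_scale)
    have "grad S F (X + s *\<^sub>R d) \<bullet> d - grad S F X \<bullet> d = (grad S F (X + s *\<^sub>R d) - grad S F X) \<bullet> d"
      by (simp add: inner_diff_left)
    also have "\<dots> \<le> norm (grad S F X - grad S F (X + s *\<^sub>R d)) * norm d"
      by (metis norm_cauchy_schwarz norm_minus_commute)
    also have "\<dots> \<le> (K * norm (X - (X + s *\<^sub>R d))) * norm d"
      using sm X Z unfolding joint_smooth_def K_def by (intro mult_right_mono norm_ge_zero) blast
    also have "\<dots> = K * s * (norm d)\<^sup>2" using s by (simp add: power2_eq_square)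
    finally show "\<exists>y. (\<phi> has_real_derivative y) (at s) \<and> y \<le> 0" using der[of s] by fastforce
  qed simp
  then show ?thesis by (simp add: \<phi>_def d_def K_def)
qed

section \<open>Joint measurability of the stochastic gradient\<close>

lemma continuous_on_grad:
  fixes S :: "'a::euclidean_space set"
  assumes sm: "joint_smooth S F L\<^sub>0 L\<^sub>1 q"
  shows "continuous_on S (grad S F)"
  unfolding continuous_on_def
proof
  fix X assume X: "X \<in> S"
  define K where "K = L\<^sub>0 + L\<^sub>1 * pow0 (norm (grad S F X)) q"
  show "(grad S F \<longlongrightarrow> grad S F X) (at X within S)"
  proof (rule LIM_zero_cancel, rule tendsto_norm_zero_cancel)
    have lim: "((\<lambda>Y. K * norm (X - Y)) \<longlongrightarrow> 0) (at X within S)"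
      by (auto intro!: tendsto_eq_intros)
    show "((\<lambda>Y. norm (grad S F Y - grad S F X)) \<longlongrightarrow> 0) (at X within S)"
      by (rule tendsto_sandwich[OF _ _ tendsto_const lim])
         (use sm X in \<open>auto simp: eventually_at_filter joint_smooth_def K_def norm_minus_commute\<close>)
  qed
qed

text \<open>Smoothness controls \<open>grad S F\<close> on \<open>S\<close> only, so the argument is
  first mapped into \<open>S\<close>.\<close>

lemma borel_measurable_grad_compose:
  fixes p :: "'a::euclidean_space \<Rightarrow> 'a"
  assumes "joint_smooth S F L\<^sub>0 L\<^sub>1 q" and "continuous_on UNIV p" and "range p \<subseteq> S"
  shows "(\<lambda>X. grad S F (p X)) \<in> borel_measurable borel"
  by (intro borel_measurable_continuous_onI continuous_on_compose2[OF continuous_on_grad[OF assms(1)] assms(2)])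
     (use assms(3) in auto)

text \<open>A Caratheodory function is the pointwise limit of its values at simple functions.\<close>

lemma caratheodory_measurable:
  fixes f :: "'a::euclidean_space \<Rightarrow> 'x \<Rightarrow> real" and p :: "'a \<Rightarrow> 'a"
  assumes meas: "\<And>Y. Y \<in> S \<Longrightarrow> f Y \<in> borel_measurable D"
    and cont: "\<And>x. x \<in> space D \<Longrightarrow> continuous_on S (\<lambda>Y. f Y x)"
    and p: "continuous_on UNIV p" "range p \<subseteq> S"
  shows "(\<lambda>(Y, x). f (p Y) x) \<in> borel_measurable (borel \<Otimes>\<^sub>M D)"
proof -
  obtain s :: "nat \<Rightarrow> 'a \<Rightarrow> 'a" where s: "\<And>i. simple_function borel (s i)" "\<And>Y. (\<lambda>i. s i Y) \<longlonglongrightarrow> Y"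
    using borel_measurable_implies_sequence_metric[of "\<lambda>Y::'a. Y" borel 0] by auto
  show ?thesis
  proof (rule borel_measurable_LIMSEQ_real)
    fix z :: "'a \<times> 'x" assume "z \<in> space (borel \<Otimes>\<^sub>M D)"
    then have x: "snd z \<in> space D" by (auto simp: space_pair_measure)
    have "isCont p (fst z)" using p(1) by (simp add: continuous_on_eq_continuous_at)
    then have "(\<lambda>i. p (s i (fst z))) \<longlonglongrightarrow> p (fst z)"
      using s(2) by (rule isCont_tendsto_compose)
    then have "(\<lambda>i. f (p (s i (fst z))) (snd z)) \<longlonglongrightarrow> f (p (fst z)) (snd z)"
      by (intro continuous_on_tendsto_compose[OF cont[OF x]]) (use p(2) in \<open>auto intro!: always_eventually\<close>)
    then show "(\<lambda>i. case z of (Y, x) \<Rightarrow> f (p (s i Y)) x) \<longlonglongrightarrow> (case z of (Y, x) \<Rightarrow> f (p Y) x)"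
      by (simp add: case_prod_beta)
  next
    fix i
    \<comment> \<open>A simple function has finite range, so measurability at each fixed parameter
      is glued along the level sets of \<open>s i\<close>.\<close>
    have "(\<lambda>z. f (p (s i (fst z))) (snd z)) \<in> borel_measurable (borel \<Otimes>\<^sub>M D)"
    proof (rule measurable_compose_countable'[where f = "\<lambda>Y z. f (p Y) (snd z)" and g = "\<lambda>z. s i (fst z)" and I = "range (s i)"])
      show "(\<lambda>z. f (p Y) (snd z)) \<in> borel_measurable (borel \<Otimes>\<^sub>M D)" for Y
        by (intro measurable_compose[OF measurable_snd meas]) (use p(2) in auto)
      have "s i \<in> measurable borel (count_space (range (s i)))"
        using s(1)[of i] by (subst measurable_count_space_eq2) (auto simp: simple_function_def)
      then show "(\<lambda>z. s i (fst z)) \<in> measurable (borel \<Otimes>\<^sub>M D) (count_space (range (s i)))"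
        by (rule measurable_compose[OF measurable_fst])
      show "countable (range (s i))"
        using s(1) by (auto simp: simple_function_def intro: countable_finite)
    qed
    then show "(\<lambda>(Y, x). f (p (s i Y)) x) \<in> borel_measurable (borel \<Otimes>\<^sub>M D)"
      by (simp add: case_prod_beta)
  qed
qed

text \<open>Each coordinate is a limit of difference quotients of \<open>f\<close>, which are
  jointly measurable by the Caratheodory argument. A coordinate direction \<open>b\<close> may leave
  \<open>S\<close>; as gradients lie in \<open>S\<close>, it can be replaced by
  \<open>p b\<close>.\<close>

lemma grad_measurable:
  fixes S :: "'a::euclidean_space set" and f :: "'a \<Rightarrow> 'x \<Rightarrow> real"
  assumes S: "subspace S"
    and meas: "\<And>Y. Y \<in> S \<Longrightarrow> f Y \<in> borel_measurable D"
    and diff: "\<And>x Y. x \<in> space D \<Longrightarrow> Y \<in> S \<Longrightarrow> (\<lambda>Z. f Z x) differentiable (at Y within S)"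
    and p: "linear p" "range p \<subseteq> S" "\<And>Y G. G \<in> S \<Longrightarrow> G \<bullet> p Y = G \<bullet> Y"
  shows "(\<lambda>(Y, x). grad S (\<lambda>Z. f Z x) (p Y)) \<in> borel_measurable (borel \<Otimes>\<^sub>M D)"
proof (subst borel_measurable_euclidean_space, intro ballI)
  fix b :: 'a assume "b \<in> Basis"
  have pS: "p Y \<in> S" for Y using p(2) by auto
  have pc: "continuous_on UNIV p" by (rule linear_continuous_on[OF p(1)[unfolded linear_conv_bounded_linear]])
  have cont: "continuous_on S (\<lambda>Y. f Y x)" if "x \<in> space D" for x
    using diff[OF that] differentiable_imp_continuous_on[of "\<lambda>Y. f Y x" S] by (auto simp: differentiable_on_def)
  have shift: "(\<lambda>(Y, x). f (p Y + c *\<^sub>R p b) x) \<in> borel_measurable (borel \<Otimes>\<^sub>M D)" for c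
    by (rule caratheodory_measurable[OF meas cont])
       (use S pS in \<open>auto intro!: continuous_intros pc subspace_add subspace_scale\<close>)
  show "(\<lambda>z. (case z of (Y, x) \<Rightarrow> grad S (\<lambda>Z. f Z x) (p Y)) \<bullet> b) \<in> borel_measurable (borel \<Otimes>\<^sub>M D)"
  proof (rule borel_measurable_LIMSEQ_real)
    fix z :: "'a \<times> 'x" assume "z \<in> space (borel \<Otimes>\<^sub>M D)"
    then have x: "snd z \<in> space D" by (auto simp: space_pair_measure)
    have "(\<lambda>n. (f (p (fst z) + (1 / real (Suc n)) *\<^sub>R p b) (snd z) - f (p (fst z)) (snd z)) * real (Suc n))
        \<longlonglongrightarrow> grad S (\<lambda>Z. f Z (snd z)) (p (fst z)) \<bullet> p b"
      by (rule grad_difference_quotient[OF S pS pS diff[OF x]])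
    also have "grad S (\<lambda>Z. f Z (snd z)) (p (fst z)) \<bullet> p b = grad S (\<lambda>Z. f Z (snd z)) (p (fst z)) \<bullet> b"
      by (rule p(3)[OF grad_props(1)[OF S pS diff[OF x pS]]])
    \<comment> \<open>The second value carries the shift \<open>0 *\<^sub>R p b\<close> so that
      \<open>shift\<close> covers both terms of the quotient.\<close>
    finally show "(\<lambda>n. (case z of (Y, x) \<Rightarrow> (f (p Y + (1 / real (Suc n)) *\<^sub>R p b) x)) * real (Suc n) - (case z of (Y, x) \<Rightarrow> f (p Y + 0 *\<^sub>R p b) x) * real (Suc n))
        \<longlonglongrightarrow> (case z of (Y, x) \<Rightarrow> grad S (\<lambda>Z. f Z x) (p Y)) \<bullet> b"
      by (simp add: case_prod_beta left_diff_distrib)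
  next
    fix n
    show "(\<lambda>z. (case z of (Y, x) \<Rightarrow> (f (p Y + (1 / real (Suc n)) *\<^sub>R p b) x)) * real (Suc n) - (case z of (Y, x) \<Rightarrow> f (p Y + 0 *\<^sub>R p b) x) * real (Suc n))
        \<in> borel_measurable (borel \<Otimes>\<^sub>M D)"
      by (intro borel_measurable_diff borel_measurable_times shift borel_measurable_const)
  qed
qed

section \<open>Averages of fresh noise\<close>

text \<open>The outcome itself, seen through \<open>\<G>\<close>, serves as the history.
  Independence is the product formula on rectangles, and rectangles determine the joint law.\<close>

lemma (in prob_space) distr_fresh_sample:
  assumes sub: "subalgebra M \<G>" and \<xi>: "\<xi> \<in> M \<rightarrow>\<^sub>M D" and law: "distr M D \<xi> = D"
    and indep: "indep_set (sets \<G>) (sets (vimage_algebra (space M) \<xi> D))"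
  shows "distr M (\<G> \<Otimes>\<^sub>M D) (\<lambda>\<omega>. (\<omega>, \<xi> \<omega>)) = restr_to_subalg M \<G> \<Otimes>\<^sub>M D"
proof -
  have id: "(\<lambda>\<omega>. \<omega>) \<in> M \<rightarrow>\<^sub>M \<G>" using sub by (auto simp: measurable_def subalgebra_def)
  have pair: "(\<lambda>\<omega>. (\<omega>, \<xi> \<omega>)) \<in> M \<rightarrow>\<^sub>M \<G> \<Otimes>\<^sub>M D" using id \<xi> by (rule measurable_Pair)
  interpret R: prob_space "restr_to_subalg M \<G>" by (rule prob_space_restr_to_subalg[OF sub prob_space_axioms])
  interpret D: prob_space D using prob_space_distr[OF \<xi>] law by simp
  have "restr_to_subalg M \<G> \<Otimes>\<^sub>M D = distr M (\<G> \<Otimes>\<^sub>M D) (\<lambda>\<omega>. (\<omega>, \<xi> \<omega>))"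
  proof (rule pair_measure_eqI)
    show "sets (restr_to_subalg M \<G> \<Otimes>\<^sub>M D) = sets (distr M (\<G> \<Otimes>\<^sub>M D) (\<lambda>\<omega>. (\<omega>, \<xi> \<omega>)))"
      by (simp add: sets_restr_to_subalg[OF sub] cong: sets_pair_measure_cong)
    fix A B assume A: "A \<in> sets (restr_to_subalg M \<G>)" and B: "B \<in> sets D"
    then have A': "A \<in> sets \<G>" by (simp add: sets_restr_to_subalg[OF sub])
    define C where "C = \<xi> -` B \<inter> space M"
    have "C \<in> sets (vimage_algebra (space M) \<xi> D)" unfolding C_def by (rule in_vimage_algebra[OF B])
    then have "prob (A \<inter> C) = prob A * prob C" using indep A' unfolding indep_sets2_eq by blast
    moreover have "emeasure D B = emeasure M C" using emeasure_distr[OF \<xi> B] by (simp add: law C_def)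
    moreover have "(\<lambda>\<omega>. (\<omega>, \<xi> \<omega>)) -` (A \<times> B) \<inter> space M = A \<inter> C" by (auto simp: C_def)
    ultimately show "emeasure (restr_to_subalg M \<G>) A * emeasure D B
        = emeasure (distr M (\<G> \<Otimes>\<^sub>M D) (\<lambda>\<omega>. (\<omega>, \<xi> \<omega>))) (A \<times> B)"
      using A' B by (simp add: emeasure_distr[OF pair] emeasure_restr_to_subalg[OF sub A']
          emeasure_eq_measure ennreal_mult)
  qed unfold_locales
  then show ?thesis ..
qed

lemma norm_inner_le_sum_squares: "\<bar>a \<bullet> b\<bar> \<le> (norm a)\<^sup>2 + (norm b)\<^sup>2"
proof -
  have "\<bar>a \<bullet> b\<bar> \<le> norm a * norm b" by (rule Cauchy_Schwarz_ineq2)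
  moreover have "2 * (norm a * norm b) \<le> (norm a)\<^sup>2 + (norm b)\<^sup>2"
    using sum_squares_bound[of "norm a" "norm b"] by simp
  moreover have "0 \<le> norm a * norm b" by simp
  ultimately show ?thesis by linarith
qed

lemma integrable_inner_of_squares:
  fixes a b :: "'a \<Rightarrow> 'b::euclidean_space"
  assumes "a \<in> borel_measurable M" "b \<in> borel_measurable M"
    and "integrable M (\<lambda>\<omega>. (norm (a \<omega>))\<^sup>2)" "integrable M (\<lambda>\<omega>. (norm (b \<omega>))\<^sup>2)"
  shows "integrable M (\<lambda>\<omega>. a \<omega> \<bullet> b \<omega>)"
proof (rule Bochner_Integration.integrable_bound[OF Bochner_Integration.integrable_add[OF assms(3,4)]])
  show "(\<lambda>\<omega>. a \<omega> \<bullet> b \<omega>) \<in> borel_measurable M" using assms(1,2) by measurable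
qed (use norm_inner_le_sum_squares in auto)

text \<open>Conditioning on the past in the form of Fubini: history and sample have a product law,
  so the inner integral is the mean or the second moment of \<open>H\<close> at a frozen past. The
  third conclusion is the martingale difference property in the form used for orthogonality.\<close>

lemma (in prob_space) fresh_noise:
  fixes H :: "'a \<times> 'x \<Rightarrow> 'b::euclidean_space"
  assumes D: "prob_space D" and sub: "subalgebra M \<G>" and \<xi>: "\<xi> \<in> M \<rightarrow>\<^sub>M D" and law: "distr M D \<xi> = D"
    and indep: "indep_set (sets \<G>) (sets (vimage_algebra (space M) \<xi> D))"
    and H: "H \<in> borel_measurable (\<G> \<Otimes>\<^sub>M D)"
    and int: "\<And>\<omega>. \<omega> \<in> space M \<Longrightarrow> integrable D (\<lambda>x. H (\<omega>, x))"
    and mean: "\<And>\<omega>. \<omega> \<in> space M \<Longrightarrow> (\<integral>x. H (\<omega>, x) \<partial>D) = 0"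
    and int2: "\<And>\<omega>. \<omega> \<in> space M \<Longrightarrow> integrable D (\<lambda>x. (norm (H (\<omega>, x)))\<^sup>2)"
    and var: "\<And>\<omega>. \<omega> \<in> space M \<Longrightarrow> (\<integral>x. (norm (H (\<omega>, x)))\<^sup>2 \<partial>D) \<le> c"
  shows "integrable M (\<lambda>\<omega>. (norm (H (\<omega>, \<xi> \<omega>)))\<^sup>2)"
    and "(\<integral>\<omega>. (norm (H (\<omega>, \<xi> \<omega>)))\<^sup>2 \<partial>M) \<le> c"
    and "\<And>a. a \<in> borel_measurable \<G> \<Longrightarrow> integrable M (\<lambda>\<omega>. (norm (a \<omega>))\<^sup>2) \<Longrightarrow> (\<integral>\<omega>. a \<omega> \<bullet> H (\<omega>, \<xi> \<omega>) \<partial>M) = 0"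
proof -
  define R where "R = restr_to_subalg M \<G>"
  have spR: "space R = space M" unfolding R_def by (simp add: space_restr_to_subalg)
  have sets_RD: "sets (R \<Otimes>\<^sub>M D) = sets (\<G> \<Otimes>\<^sub>M D)"
    unfolding R_def by (intro sets_pair_measure_cong sets_restr_to_subalg sub refl)
  interpret R: prob_space R unfolding R_def by (rule prob_space_restr_to_subalg[OF sub prob_space_axioms])
  interpret D: prob_space D by fact
  interpret RD: pair_prob_space R D ..
  have pair: "(\<lambda>\<omega>. (\<omega>, \<xi> \<omega>)) \<in> M \<rightarrow>\<^sub>M \<G> \<Otimes>\<^sub>M D"
    using sub \<xi> by (intro measurable_Pair) (auto simp: measurable_def subalgebra_def)
  have eq: "distr M (\<G> \<Otimes>\<^sub>M D) (\<lambda>\<omega>. (\<omega>, \<xi> \<omega>)) = R \<Otimes>\<^sub>M D"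
    unfolding R_def by (rule distr_fresh_sample[OF sub \<xi> law indep])
  have H': "H \<in> borel_measurable (R \<Otimes>\<^sub>M D)" using H by (simp cong: measurable_cong_sets add: sets_RD)
  have HM: "(\<lambda>\<omega>. H (\<omega>, \<xi> \<omega>)) \<in> borel_measurable M" by (rule measurable_compose[OF pair H])
  \<comment> \<open>Tonelli for the nonnegative integral comes first, so that integrability of the
    square results from the estimate.\<close>
  have "(\<integral>\<^sup>+\<omega>. ennreal ((norm (H (\<omega>, \<xi> \<omega>)))\<^sup>2) \<partial>M) = (\<integral>\<^sup>+z. ennreal ((norm (H z))\<^sup>2) \<partial>(R \<Otimes>\<^sub>M D))"
    unfolding eq[symmetric] by (subst nn_integral_distr[OF pair]) (use H in auto)
  also have "\<dots> = (\<integral>\<^sup>+\<omega>. \<integral>\<^sup>+x. ennreal ((norm (H (\<omega>, x)))\<^sup>2) \<partial>D \<partial>R)"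
    by (rule D.nn_integral_fst[symmetric]) (use H' in measurable)
  also have "\<dots> \<le> (\<integral>\<^sup>+\<omega>. ennreal c \<partial>R)"
    by (rule nn_integral_mono) (simp add: nn_integral_eq_integral int2 var spR ennreal_leI)
  also have "\<dots> = ennreal c" by (simp add: R.emeasure_space_1)
  finally have le: "(\<integral>\<^sup>+\<omega>. ennreal ((norm (H (\<omega>, \<xi> \<omega>)))\<^sup>2) \<partial>M) \<le> ennreal c" .
  show sq: "integrable M (\<lambda>\<omega>. (norm (H (\<omega>, \<xi> \<omega>)))\<^sup>2)"
    by (rule integrableI_bounded) (use HM le in \<open>auto intro: le_less_trans\<close>)
  \<comment> \<open>Nonnegativity of \<open>c\<close> has to be extracted, because
    \<open>ennreal\<close> sends negative numbers to zero.\<close>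
  obtain \<omega>\<^sub>0 where "\<omega>\<^sub>0 \<in> space M" using not_empty by auto
  then have c: "0 \<le> c" using var[of \<omega>\<^sub>0] Bochner_Integration.integral_nonneg[of D "\<lambda>x. (norm (H (\<omega>\<^sub>0, x)))\<^sup>2"]
    by (meson order_trans zero_le_power2)
  show "(\<integral>\<omega>. (norm (H (\<omega>, \<xi> \<omega>)))\<^sup>2 \<partial>M) \<le> c"
    using le c by (simp add: nn_integral_eq_integral sq)
  fix a :: "'a \<Rightarrow> 'b" assume a: "a \<in> borel_measurable \<G>" "integrable M (\<lambda>\<omega>. (norm (a \<omega>))\<^sup>2)"
  have aM: "a \<in> borel_measurable M" by (rule measurable_from_subalg[OF sub a(1)])
  have i1: "integrable M (\<lambda>\<omega>. a \<omega> \<bullet> H (\<omega>, \<xi> \<omega>))"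
    by (rule integrable_inner_of_squares[OF aM HM a(2) sq])
  have mz: "(\<lambda>z. a (fst z) \<bullet> H z) \<in> borel_measurable (\<G> \<Otimes>\<^sub>M D)"
    by (intro borel_measurable_inner measurable_compose[OF measurable_fst a(1)] H)
  have i2: "integrable (R \<Otimes>\<^sub>M D) (\<lambda>z. a (fst z) \<bullet> H z)"
    unfolding eq[symmetric] using i1 by (subst integrable_distr_eq[OF pair mz]) simp
  have "(\<integral>\<omega>. a \<omega> \<bullet> H (\<omega>, \<xi> \<omega>) \<partial>M) = (\<integral>z. a (fst z) \<bullet> H z \<partial>(R \<Otimes>\<^sub>M D))"
    unfolding eq[symmetric] by (subst integral_distr[OF pair mz]) simp
  also have "\<dots> = (\<integral>\<omega>. \<integral>x. a \<omega> \<bullet> H (\<omega>, x) \<partial>D \<partial>R)"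
    using RD.integral_fst'[OF i2] by simp
  also have "\<dots> = (\<integral>\<omega>. 0 \<partial>R)"
    by (rule Bochner_Integration.integral_cong) (simp_all add: spR int mean)
  finally show "(\<integral>\<omega>. a \<omega> \<bullet> H (\<omega>, \<xi> \<omega>) \<partial>M) = 0" by simp
qed

lemma integral_square_orthogonal_combination:
  fixes a b :: "'a \<Rightarrow> 'b::euclidean_space" and x y :: real
  assumes "a \<in> borel_measurable M" "b \<in> borel_measurable M"
    and a: "integrable M (\<lambda>\<omega>. (norm (a \<omega>))\<^sup>2)" and b: "integrable M (\<lambda>\<omega>. (norm (b \<omega>))\<^sup>2)"
    and orth: "(\<integral>\<omega>. a \<omega> \<bullet> b \<omega> \<partial>M) = 0"
  shows "integrable M (\<lambda>\<omega>. (norm (x *\<^sub>R a \<omega> + y *\<^sub>R b \<omega>))\<^sup>2)"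
    and "(\<integral>\<omega>. (norm (x *\<^sub>R a \<omega> + y *\<^sub>R b \<omega>))\<^sup>2 \<partial>M)
      = x\<^sup>2 * (\<integral>\<omega>. (norm (a \<omega>))\<^sup>2 \<partial>M) + y\<^sup>2 * (\<integral>\<omega>. (norm (b \<omega>))\<^sup>2 \<partial>M)"
proof -
  have eq: "(norm (x *\<^sub>R a \<omega> + y *\<^sub>R b \<omega>))\<^sup>2
      = x\<^sup>2 * (norm (a \<omega>))\<^sup>2 + y\<^sup>2 * (norm (b \<omega>))\<^sup>2 + (2 * x * y) * (a \<omega> \<bullet> b \<omega>)" for \<omega>
    by (simp add: power2_norm_eq_inner inner_add_left inner_add_right inner_commute[of "b \<omega>" "a \<omega>"]
        power2_eq_square[of x] power2_eq_square[of y] algebra_simps)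
  have ab: "integrable M (\<lambda>\<omega>. a \<omega> \<bullet> b \<omega>)" by (rule integrable_inner_of_squares[OF assms(1,2) a b])
  show "integrable M (\<lambda>\<omega>. (norm (x *\<^sub>R a \<omega> + y *\<^sub>R b \<omega>))\<^sup>2)" unfolding eq using a b ab by auto
  show "(\<integral>\<omega>. (norm (x *\<^sub>R a \<omega> + y *\<^sub>R b \<omega>))\<^sup>2 \<partial>M)
      = x\<^sup>2 * (\<integral>\<omega>. (norm (a \<omega>))\<^sup>2 \<partial>M) + y\<^sup>2 * (\<integral>\<omega>. (norm (b \<omega>))\<^sup>2 \<partial>M)"
    unfolding eq using a b ab orth by simp
qed

section \<open>Second moments of averaged noise\<close>

text \<open>The recursion of the momentum buffer as an operator on sequences. By linearity, the
  noise part of the buffer is this operator applied to the gradient errors.\<close>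

primrec momentum :: "real \<Rightarrow> (nat \<Rightarrow> 'b::real_vector) \<Rightarrow> nat \<Rightarrow> 'b" where
  "momentum \<beta> e 0 = 0"
| "momentum \<beta> e (Suc t) = \<beta> *\<^sub>R momentum \<beta> e t + (1 - \<beta>) *\<^sub>R e (Suc t)"

text \<open>Origin of the two square roots of the theorem. With
  \<open>p = \<beta>\<^sub>1 * \<beta>\<^sub>2\<close>, the first summand is at most
  \<open>(1 - \<beta>\<^sub>1) * p\<close>; the radicand then becomes
  \<open>1 - \<beta>\<^sub>1\<close> plus \<open>(1 - p) * (\<beta>\<^sub>1 - p)\<close>, where
  \<open>\<beta>\<^sub>1 - p = \<beta>\<^sub>1 * (1 - \<beta>\<^sub>2)\<close>. The factor
  \<open>2\<close> under the last root is slack.\<close>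

lemma sqrt_variance_le:
  assumes "0 \<le> \<beta>\<^sub>1" "\<beta>\<^sub>1 < 1" "0 \<le> \<beta>\<^sub>2" "\<beta>\<^sub>2 \<le> (1::real)"
  shows "sqrt ((\<beta>\<^sub>1 * \<beta>\<^sub>2)\<^sup>2 * ((1 - \<beta>\<^sub>1) / (1 + \<beta>\<^sub>1)) + (1 - \<beta>\<^sub>1 * \<beta>\<^sub>2)\<^sup>2)
    \<le> sqrt (1 - \<beta>\<^sub>1) + sqrt (2 * \<beta>\<^sub>1 * (1 - \<beta>\<^sub>1 * \<beta>\<^sub>2) * (1 - \<beta>\<^sub>2))"
proof -
  define p where "p = \<beta>\<^sub>1 * \<beta>\<^sub>2"
  have p: "0 \<le> p" "p \<le> 1" "p \<le> \<beta>\<^sub>1" unfolding p_def using assms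
    by (auto intro: mult_le_one mult_left_le)
  have "p * (1 / (1 + \<beta>\<^sub>1)) \<le> p * 1" using p assms by (intro mult_left_mono) auto
  then have "p * (p * (1 / (1 + \<beta>\<^sub>1))) \<le> 1 * p" using p by (intro mult_mono) (use assms in auto)
  then have "(1 - \<beta>\<^sub>1) * (p\<^sup>2 * (1 / (1 + \<beta>\<^sub>1))) \<le> (1 - \<beta>\<^sub>1) * p"
    using assms by (intro mult_left_mono) (auto simp: power2_eq_square)
  then have 1: "p\<^sup>2 * ((1 - \<beta>\<^sub>1) / (1 + \<beta>\<^sub>1)) \<le> (1 - \<beta>\<^sub>1) * p" by (simp add: mult.commute)
  have "(1 - \<beta>\<^sub>1) * p + (1 - p)\<^sup>2 = (1 - \<beta>\<^sub>1) + (1 - p) * (\<beta>\<^sub>1 - p)"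
    by (simp add: power2_eq_square algebra_simps)
  also have "\<beta>\<^sub>1 - p = \<beta>\<^sub>1 * (1 - \<beta>\<^sub>2)" by (simp add: p_def algebra_simps)
  also have "(1 - p) * (\<beta>\<^sub>1 * (1 - \<beta>\<^sub>2)) \<le> 2 * ((1 - p) * (\<beta>\<^sub>1 * (1 - \<beta>\<^sub>2)))"
    using p assms by simp
  finally have "p\<^sup>2 * ((1 - \<beta>\<^sub>1) / (1 + \<beta>\<^sub>1)) + (1 - p)\<^sup>2 \<le> (1 - \<beta>\<^sub>1) + 2 * \<beta>\<^sub>1 * (1 - p) * (1 - \<beta>\<^sub>2)"
    using 1 by (simp add: mult_ac)
  then have "sqrt (p\<^sup>2 * ((1 - \<beta>\<^sub>1) / (1 + \<beta>\<^sub>1)) + (1 - p)\<^sup>2) \<le> sqrt ((1 - \<beta>\<^sub>1) + 2 * \<beta>\<^sub>1 * (1 - p) * (1 - \<beta>\<^sub>2))"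
    by simp
  also have "\<dots> \<le> sqrt (1 - \<beta>\<^sub>1) + sqrt (2 * \<beta>\<^sub>1 * (1 - p) * (1 - \<beta>\<^sub>2))"
    by (rule sqrt_add_le_add_sqrt) (use p assms in auto)
  finally show ?thesis by (simp add: p_def)
qed

text \<open>Past averages are orthogonal to the fresh error, so second moments add without cross
  terms; the first moment follows by Jensen.\<close>

lemma (in prob_space) momentum_noise:
  fixes e :: "nat \<Rightarrow> 'a \<Rightarrow> 'b::euclidean_space"
  assumes sub: "\<And>t. subalgebra M (\<F> t)" and mono: "\<And>s t. s \<le> t \<Longrightarrow> sets (\<F> s) \<subseteq> sets (\<F> t)"
    and meas: "\<And>t. t \<in> {1..T} \<Longrightarrow> e t \<in> borel_measurable (\<F> t)"
    and int2: "\<And>t. t \<in> {1..T} \<Longrightarrow> integrable M (\<lambda>\<omega>. (norm (e t \<omega>))\<^sup>2)"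
    and var: "\<And>t. t \<in> {1..T} \<Longrightarrow> (\<integral>\<omega>. (norm (e t \<omega>))\<^sup>2 \<partial>M) \<le> c\<^sup>2"
    and orth: "\<And>t a. t \<in> {1..T} \<Longrightarrow> a \<in> borel_measurable (\<F> (t - 1)) \<Longrightarrow>
      integrable M (\<lambda>\<omega>. (norm (a \<omega>))\<^sup>2) \<Longrightarrow> (\<integral>\<omega>. a \<omega> \<bullet> e t \<omega> \<partial>M) = 0"
    and \<beta>: "0 \<le> \<beta>\<^sub>1" "\<beta>\<^sub>1 < 1" "0 \<le> \<beta>\<^sub>2" "\<beta>\<^sub>2 \<le> 1" and c: "0 \<le> c" and t: "t \<in> {1..T}"
  defines "W \<equiv> \<lambda>\<omega>. \<beta>\<^sub>2 *\<^sub>R momentum \<beta>\<^sub>1 (\<lambda>s. e s \<omega>) t + (1 - \<beta>\<^sub>2) *\<^sub>R e t \<omega>"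
  shows "integrable M (\<lambda>\<omega>. norm (W \<omega>))"
    and "(\<integral>\<omega>. norm (W \<omega>) \<partial>M) \<le> (sqrt (1 - \<beta>\<^sub>1) + sqrt (2 * \<beta>\<^sub>1 * (1 - \<beta>\<^sub>1 * \<beta>\<^sub>2) * (1 - \<beta>\<^sub>2))) * c"
proof -
  define V where "V s \<omega> = momentum \<beta>\<^sub>1 (\<lambda>s. e s \<omega>) s" for s \<omega>
  have measM: "g \<in> borel_measurable M" if "g \<in> borel_measurable (\<F> s)" for s and g :: "'a \<Rightarrow> 'b"
    by (rule measurable_from_subalg[OF sub that])
  \<comment> \<open>The factor \<open>(1 - \<beta>\<^sub>1) / (1 + \<beta>\<^sub>1)\<close> is the
    fixed point of the second-moment recursion sending \<open>v\<close> to
    \<open>\<beta>\<^sub>1\<^sup>2 * v + (1 - \<beta>\<^sub>1)\<^sup>2\<close>; the start at zero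
    lies below it.\<close>
  have V: "V s \<in> borel_measurable (\<F> s) \<and> integrable M (\<lambda>\<omega>. (norm (V s \<omega>))\<^sup>2)
      \<and> (\<integral>\<omega>. (norm (V s \<omega>))\<^sup>2 \<partial>M) \<le> (1 - \<beta>\<^sub>1) / (1 + \<beta>\<^sub>1) * c\<^sup>2" if "s \<le> T" for s
    using that
  proof (induction s)
    case 0
    then show ?case using \<beta> by (simp add: V_def)
  next
    case (Suc s)
    then have IH: "V s \<in> borel_measurable (\<F> s)" "integrable M (\<lambda>\<omega>. (norm (V s \<omega>))\<^sup>2)"
      "(\<integral>\<omega>. (norm (V s \<omega>))\<^sup>2 \<partial>M) \<le> (1 - \<beta>\<^sub>1) / (1 + \<beta>\<^sub>1) * c\<^sup>2" by auto
    have s: "Suc s \<in> {1..T}" using Suc.prems by simp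
    have VS: "V (Suc s) = (\<lambda>\<omega>. \<beta>\<^sub>1 *\<^sub>R V s \<omega> + (1 - \<beta>\<^sub>1) *\<^sub>R e (Suc s) \<omega>)" by (simp add: V_def fun_eq_iff)
    have o: "(\<integral>\<omega>. V s \<omega> \<bullet> e (Suc s) \<omega> \<partial>M) = 0" using orth[OF s] IH(1,2) by simp
    note comb = integral_square_orthogonal_combination[OF measM[OF IH(1)] measM[OF meas[OF s]] IH(2) int2[OF s] o,
        of \<beta>\<^sub>1 "1 - \<beta>\<^sub>1"]
    have "V s \<in> borel_measurable (\<F> (Suc s))"
    proof (rule measurable_from_subalg[OF _ IH(1)])
      show "subalgebra (\<F> (Suc s)) (\<F> s)"
        using sub[of s] sub[of "Suc s"] mono[of s "Suc s"] by (auto simp: subalgebra_def)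
    qed
    moreover have "(\<integral>\<omega>. (norm (V (Suc s) \<omega>))\<^sup>2 \<partial>M) \<le> (1 - \<beta>\<^sub>1) / (1 + \<beta>\<^sub>1) * c\<^sup>2"
    proof -
      have "(\<integral>\<omega>. (norm (V (Suc s) \<omega>))\<^sup>2 \<partial>M) \<le> \<beta>\<^sub>1\<^sup>2 * ((1 - \<beta>\<^sub>1) / (1 + \<beta>\<^sub>1) * c\<^sup>2) + (1 - \<beta>\<^sub>1)\<^sup>2 * c\<^sup>2"
        unfolding VS comb(2) by (intro add_mono mult_left_mono IH(3) var[OF s]) auto
      also have "\<dots> = (\<beta>\<^sub>1\<^sup>2 * ((1 - \<beta>\<^sub>1) / (1 + \<beta>\<^sub>1)) + (1 - \<beta>\<^sub>1)\<^sup>2) * c\<^sup>2" by (simp add: algebra_simps)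
      also have "\<beta>\<^sub>1\<^sup>2 * ((1 - \<beta>\<^sub>1) / (1 + \<beta>\<^sub>1)) + (1 - \<beta>\<^sub>1)\<^sup>2 = (1 - \<beta>\<^sub>1) / (1 + \<beta>\<^sub>1)"
        using \<beta> by (simp add: field_simps power2_eq_square)
      finally show ?thesis .
    qed
    ultimately show ?case using comb(1) meas[OF s] unfolding VS by auto
  qed
  obtain s where s: "t = Suc s" using t by (cases t) auto
  have Vs: "V s \<in> borel_measurable (\<F> s)" "integrable M (\<lambda>\<omega>. (norm (V s \<omega>))\<^sup>2)"
    "(\<integral>\<omega>. (norm (V s \<omega>))\<^sup>2 \<partial>M) \<le> (1 - \<beta>\<^sub>1) / (1 + \<beta>\<^sub>1) * c\<^sup>2" using V[of s] t s by auto
  have o: "(\<integral>\<omega>. V s \<omega> \<bullet> e t \<omega> \<partial>M) = 0" using orth[OF t] Vs(1,2) s by simp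
  \<comment> \<open>The current average already contains \<open>e t\<close>, so \<open>W\<close> is
    regrouped into the previous average and the fresh error, which are orthogonal.\<close>
  have W: "W \<omega> = (\<beta>\<^sub>1 * \<beta>\<^sub>2) *\<^sub>R V s \<omega> + (1 - \<beta>\<^sub>1 * \<beta>\<^sub>2) *\<^sub>R e t \<omega>" for \<omega>
    by (simp add: W_def s V_def algebra_simps)
  note comb = integral_square_orthogonal_combination[OF measM[OF Vs(1)] measM[OF meas[OF t]] Vs(2) int2[OF t] o,
      of "\<beta>\<^sub>1 * \<beta>\<^sub>2" "1 - \<beta>\<^sub>1 * \<beta>\<^sub>2"]
  have WM: "W \<in> borel_measurable M" unfolding W using measM[OF Vs(1)] measM[OF meas[OF t]] by measurable
  have W2: "integrable M (\<lambda>\<omega>. (norm (W \<omega>))\<^sup>2)" unfolding W by (rule comb(1))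
  show Wi: "integrable M (\<lambda>\<omega>. norm (W \<omega>))"
    by (rule square_integrable_imp_integrable) (use WM W2 in auto)
  have "(\<integral>\<omega>. (norm (W \<omega>))\<^sup>2 \<partial>M) \<le> (\<beta>\<^sub>1 * \<beta>\<^sub>2)\<^sup>2 * ((1 - \<beta>\<^sub>1) / (1 + \<beta>\<^sub>1) * c\<^sup>2) + (1 - \<beta>\<^sub>1 * \<beta>\<^sub>2)\<^sup>2 * c\<^sup>2"
    unfolding W comb(2) by (intro add_mono mult_left_mono Vs(3) var[OF t]) auto
  also have "\<dots> = ((\<beta>\<^sub>1 * \<beta>\<^sub>2)\<^sup>2 * ((1 - \<beta>\<^sub>1) / (1 + \<beta>\<^sub>1)) + (1 - \<beta>\<^sub>1 * \<beta>\<^sub>2)\<^sup>2) * c\<^sup>2" by (simp add: algebra_simps)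
  finally have v: "(\<integral>\<omega>. (norm (W \<omega>))\<^sup>2 \<partial>M)
    \<le> ((\<beta>\<^sub>1 * \<beta>\<^sub>2)\<^sup>2 * ((1 - \<beta>\<^sub>1) / (1 + \<beta>\<^sub>1)) + (1 - \<beta>\<^sub>1 * \<beta>\<^sub>2)\<^sup>2) * c\<^sup>2" .
  \<comment> \<open>Jensen's inequality for the square, read off from nonnegativity of the
    variance.\<close>
  have "0 \<le> variance (\<lambda>\<omega>. norm (W \<omega>))" by (rule variance_positive)
  then have "(\<integral>\<omega>. norm (W \<omega>) \<partial>M)\<^sup>2 \<le> (\<integral>\<omega>. (norm (W \<omega>))\<^sup>2 \<partial>M)"
    using variance_eq[OF Wi W2] by simp
  then have "(\<integral>\<omega>. norm (W \<omega>) \<partial>M) \<le> sqrt (\<integral>\<omega>. (norm (W \<omega>))\<^sup>2 \<partial>M)" by (rule real_le_rsqrt)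
  also have "\<dots> \<le> sqrt (((\<beta>\<^sub>1 * \<beta>\<^sub>2)\<^sup>2 * ((1 - \<beta>\<^sub>1) / (1 + \<beta>\<^sub>1)) + (1 - \<beta>\<^sub>1 * \<beta>\<^sub>2)\<^sup>2) * c\<^sup>2)"
    using v by (rule real_sqrt_le_mono)
  also have "\<dots> = sqrt ((\<beta>\<^sub>1 * \<beta>\<^sub>2)\<^sup>2 * ((1 - \<beta>\<^sub>1) / (1 + \<beta>\<^sub>1)) + (1 - \<beta>\<^sub>1 * \<beta>\<^sub>2)\<^sup>2) * c"
    using c by (simp add: real_sqrt_mult)
  also have "\<dots> \<le> (sqrt (1 - \<beta>\<^sub>1) + sqrt (2 * \<beta>\<^sub>1 * (1 - \<beta>\<^sub>1 * \<beta>\<^sub>2) * (1 - \<beta>\<^sub>2))) * c"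
    by (rule mult_right_mono[OF sqrt_variance_le[OF \<beta>] c])
  finally show "(\<integral>\<omega>. norm (W \<omega>) \<partial>M) \<le> (sqrt (1 - \<beta>\<^sub>1) + sqrt (2 * \<beta>\<^sub>1 * (1 - \<beta>\<^sub>1 * \<beta>\<^sub>2) * (1 - \<beta>\<^sub>2))) * c" .
qed

section \<open>The orthogonalization routine\<close>

lemma norm_vec_square: "(norm x)\<^sup>2 = (\<Sum>i\<in>UNIV. (norm (x $ i))\<^sup>2)"
  by (simp add: norm_vec_def L2_set_def sum_nonneg)

lemma norm_le_sum_norm_nth: "norm x \<le> (\<Sum>i\<in>UNIV. norm (x $ i))"
  unfolding norm_vec_def by (rule L2_set_le_sum) simp

text \<open>Cauchy-Schwarz over the layers: the passage from the joint norm, in which the drift is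
  bounded, to rank-weighted layer norms.\<close>

lemma sum_sqrt_mult_norm_nth_le:
  "(\<Sum>i\<in>UNIV. sqrt (real (r i)) * norm (x $ i)) \<le> sqrt (\<Sum>i\<in>UNIV. real (r i)) * norm x"
proof -
  have "(\<Sum>i\<in>UNIV. sqrt (real (r i)) * norm (x $ i)) = (\<Sum>i\<in>UNIV. \<bar>sqrt (real (r i))\<bar> * \<bar>norm (x $ i)\<bar>)"
    by simp
  also have "\<dots> \<le> L2_set (\<lambda>i. sqrt (real (r i))) UNIV * L2_set (\<lambda>i. norm (x $ i)) UNIV"
    by (rule L2_set_mult_ineq)
  finally show ?thesis by (simp add: norm_vec_def L2_set_def)
qed

lemma nuclear_norm_0: "nuclear_norm (0 :: real^'m::finite^'n::finite) = 0"
  using nuclear_norm_le_frobenius[of "0 :: real^'m^'n"] nuclear_norm_nonneg[of "0 :: real^'m^'n"] by simp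

lemma nuclear_norm_minus: "nuclear_norm (- A) = nuclear_norm A"
proof -
  have "nuclear_norm (- A) \<le> nuclear_norm A" for A :: "real^'a::finite^'b::finite"
  proof -
    obtain B where B: "onb B" "nuclear_norm A = (\<Sum>b\<in>B. norm (A *v b))" by (metis nuclear_norm_attained)
    have "(- A) *v b = - (A *v b)" for b by (simp add: vec_eq_iff matrix_vector_mul_component)
    then show ?thesis using nuclear_norm_le_sum_norm[OF B(1), of "- A"] B(2) by simp
  qed
  from this[of A] this[of "- A"] show ?thesis by simp
qed

lemma spectral_conditionE:
  assumes "spectral_condition smin smax N Q" "N \<noteq> 0"
  obtains k u s v c where "k = rank N" "orthonormal_columns k u" "orthonormal_columns k v"
    "\<forall>i<k. 0 < s i" "N = U_diag_VT k u s v" "\<forall>i<k. smin \<le> c i \<and> c i \<le> smax" "Q = U_diag_VT k u c v"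
proof -
  have "\<exists>r u s v c. compact_svd N r u s v \<and> (\<forall>i<r. smin \<le> c i \<and> c i \<le> smax) \<and> Q = U_diag_VT r u c v"
    using assms(1) unfolding spectral_condition_def by (rule conjE) (rule mp, assumption, rule assms(2))
  then show thesis
    unfolding compact_svd_def by (elim exE conjE) (rule that)
qed

text \<open>Input and output share their singular vectors, so the pairing is the sum of the products
  \<open>s i * c i\<close>.\<close>

lemma spectral_condition_inner:
  assumes "spectral_condition smin smax N Q" "0 \<le> smin"
  shows "smin * nuclear_norm N \<le> N \<bullet> Q"
proof (cases "N = 0")
  case True
  then show ?thesis by (simp add: nuclear_norm_0)
next
  case False
  obtain k u s v c where u: "orthonormal_columns k u" and v: "orthonormal_columns k v"
    and s: "\<forall>i<k. 0 < s i" and N: "N = U_diag_VT k u s v"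
    and c: "\<forall>i<k. smin \<le> c i \<and> c i \<le> smax" and Q: "Q = U_diag_VT k u c v"
    by (rule spectral_conditionE[OF assms(1) False])
  have 1: "nuclear_norm N \<le> (\<Sum>i<k. s i)" unfolding N
    by (rule nuclear_norm_U_diag_VT_le[OF u v]) (simp add: s less_imp_le)
  have 2: "N \<bullet> Q = (\<Sum>i<k. s i * c i)" unfolding N Q by (rule inner_U_diag_VT[OF u v])
  have 3: "(\<Sum>i<k. s i * smin) \<le> (\<Sum>i<k. s i * c i)"
    by (intro sum_mono mult_left_mono) (simp_all add: s c less_imp_le)
  have "smin * nuclear_norm N \<le> smin * (\<Sum>i<k. s i)" using 1 assms(2) by (rule mult_left_mono)
  also have "\<dots> = (\<Sum>i<k. s i * smin)" by (simp add: sum_distrib_left mult.commute)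
  finally show ?thesis using 2 3 by linarith
qed

lemma spectral_condition_norm:
  assumes "spectral_condition smin smax N Q" "0 \<le> smin" "0 \<le> smax"
  shows "norm Q \<le> smax * sqrt (real (rank N))"
proof (cases "N = 0")
  case False
  obtain k u v c where k: "k = rank N" and u: "orthonormal_columns k u" and v: "orthonormal_columns k v"
    and c: "\<forall>i<k. smin \<le> c i \<and> c i \<le> smax" and Q: "Q = U_diag_VT k u c v"
    by (rule spectral_conditionE[OF assms(1) False])
  have "(norm Q)\<^sup>2 = (\<Sum>i<k. c i * c i)"
    unfolding power2_norm_eq_inner Q by (rule inner_U_diag_VT[OF u v])
  also have "\<dots> \<le> (\<Sum>i<k. smax * smax)"
    using c assms by (intro sum_mono mult_mono) (auto intro: order_trans[OF assms(2)])
  also have "\<dots> = (smax * sqrt (real k))\<^sup>2" by (simp add: power_mult_distrib power2_eq_square)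
  finally show ?thesis unfolding k[symmetric] by (rule power2_le_imp_le) (use assms in simp)
qed (use assms in \<open>auto simp: spectral_condition_def\<close>)

text \<open>A nonzero matrix has at least one singular vector pair, and its factor
  \<open>c 0\<close> witnesses that the interval is nonempty.\<close>

lemma spectral_condition_min_le_max:
  assumes "spectral_condition smin smax N Q" "N \<noteq> 0"
  shows "smin \<le> smax"
proof -
  obtain k u s v c where N: "N = U_diag_VT k u s v" and c: "\<forall>i<k. smin \<le> c i \<and> c i \<le> smax"
    by (rule spectral_conditionE[OF assms])
  have "k \<noteq> 0"
  proof
    assume "k = 0"
    with N have "N = 0" by (simp add: vec_eq_iff U_diag_VT_def)
    then show False using assms(2) by simp
  qed
  then have "smin \<le> c 0 \<and> c 0 \<le> smax" using c by simp
  then show ?thesis by simp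
qed

text \<open>Keeps the padding zero: singular vectors with positive singular value lie in the row and
  column spaces of \<open>N\<close>, so they vanish wherever a whole row or column of
  \<open>N\<close> does.\<close>

lemma spectral_condition_support:
  assumes Q: "spectral_condition smin smax N Q"
    and N: "(\<forall>j. N $ i $ j = 0) \<or> (\<forall>i. N $ i $ j = 0)"
  shows "Q $ i $ j = 0"
proof (cases "N = 0")
  case False
  obtain k u s v c where u: "orthonormal_columns k u" and v: "orthonormal_columns k v"
    and s: "\<forall>i<k. 0 < s i" and NU: "N = U_diag_VT k u s v" and Q: "Q = U_diag_VT k u c v"
    by (rule spectral_conditionE[OF Q False])
  \<comment> \<open>Pairing a zero row \<open>i\<close> with \<open>v a\<close> isolates
    \<open>u a $ i * s a\<close>; pairing a zero column \<open>j\<close> with \<open>u a\<close>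
    isolates \<open>s a * v a $ j\<close>. Positivity of \<open>s a\<close> removes that
    factor.\<close>
  have "u a $ i * v a $ j = 0" if a: "a < k" for a
  proof (cases "\<forall>j. N $ i $ j = 0")
    case True
    then have "N $ i = 0" by (simp add: vec_eq_iff)
    then have "0 = (N $ i) \<bullet> v a" by simp
    also have "\<dots> = (\<Sum>b<k. if b = a then u b $ i * s b else 0)"
      unfolding NU U_diag_VT_row inner_sum_left using v a
      by (intro sum.cong refl) (auto simp: orthonormal_columns_def)
    also have "\<dots> = u a $ i * s a" using a by simp
    finally show ?thesis using s a by auto
  next
    case False
    then have "\<forall>i. N $ i $ j = 0" using N by blast
    then have "0 = (\<Sum>i\<in>UNIV. u a $ i * N $ i $ j)" by simp
    also have "\<dots> = (\<Sum>i\<in>UNIV. \<Sum>b<k. (u a $ i * u b $ i) * (s b * v b $ j))"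
      unfolding NU U_diag_VT_def by (simp add: sum_distrib_left mult_ac)
    also have "\<dots> = (\<Sum>b<k. (u a \<bullet> u b) * (s b * v b $ j))"
      by (subst sum.swap) (simp add: inner_vec_def sum_distrib_right)
    also have "\<dots> = (\<Sum>b<k. if b = a then s b * v b $ j else 0)"
      using u a by (intro sum.cong refl) (auto simp: orthonormal_columns_def)
    also have "\<dots> = s a * v a $ j" using a by simp
    finally show ?thesis using s a by auto
  qed
  then have "(\<Sum>a<k. u a $ i * c a * v a $ j) = 0" by (intro sum.neutral) auto
  then show ?thesis unfolding Q U_diag_VT_def by simp
qed (use Q in \<open>auto simp: spectral_condition_def\<close>)

text \<open>The error \<open>N - g\<close> is paid twice, once in the pairing with \<open>Q\<close>
  and once when the nuclear norm of \<open>N\<close> is exchanged for that of \<open>g\<close>;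
  hence the factor \<open>2\<close>. The second payment has weight \<open>smin\<close>, and
  \<open>smin \<le> smax\<close> allows both to be written with \<open>smax\<close>.\<close>

lemma layer_descent:
  fixes N g Q :: "real^'m::finite^'n::finite"
  assumes spec: "spectral_condition smin smax N Q" and s: "0 < smin" "smin \<le> smax"
    and rN: "rank N \<le> r" and rE: "rank (N - g) \<le> r"
  shows "smin * nuclear_norm g - 2 * smax * (sqrt (real r) * norm (N - g)) \<le> g \<bullet> Q"
proof -
  have sr: "0 \<le> sqrt (real r) * norm (N - g)" by simp
  have "norm Q \<le> smax * sqrt (real (rank N))" using spectral_condition_norm[OF spec] s by simp
  also have "\<dots> \<le> smax * sqrt (real r)" using rN s by (intro mult_left_mono) auto
  finally have Q: "norm Q \<le> smax * sqrt (real r)" .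
  have "(N - g) \<bullet> Q \<le> norm (N - g) * norm Q" by (rule norm_cauchy_schwarz)
  also have "\<dots> \<le> norm (N - g) * (smax * sqrt (real r))" using Q by (rule mult_left_mono) simp
  finally have 1: "(N - g) \<bullet> Q \<le> smax * (sqrt (real r) * norm (N - g))" by (simp add: mult_ac)
  have 2: "smin * nuclear_norm N \<le> N \<bullet> Q" using spectral_condition_inner[OF spec] s by auto
  have "nuclear_norm g \<le> nuclear_norm N + nuclear_norm (- (N - g))"
    using nuclear_norm_triangle[of N "- (N - g)"] by simp
  also have "nuclear_norm (- (N - g)) \<le> sqrt (real (rank (N - g))) * norm (N - g)"
    unfolding nuclear_norm_minus by (rule nuclear_norm_le_frobenius)
  also have "\<dots> \<le> sqrt (real r) * norm (N - g)" using rE by (intro mult_right_mono) auto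
  finally have "smin * nuclear_norm g \<le> smin * (nuclear_norm N + sqrt (real r) * norm (N - g))"
    using s by (intro mult_left_mono) auto
  also have "\<dots> \<le> smin * nuclear_norm N + smax * (sqrt (real r) * norm (N - g))"
    using mult_right_mono[OF s(2) sr] by (simp add: algebra_simps)
  finally show ?thesis using 1 2 by (simp add: inner_diff_left)
qed

text \<open>Every input \<open>b\<close> or \<open>k t\<close> is damped by \<open>\<beta>\<close>
  at each later step, so it contributes at most a geometric series to the sum.\<close>

lemma sum_contractive_recursion_le:
  fixes A k :: "nat \<Rightarrow> real"
  assumes \<beta>: "0 \<le> \<beta>" "\<beta> \<le> 1" and b: "0 \<le> b" and k: "\<And>t. 0 \<le> k t" and A: "\<And>t. 0 \<le> A t"
    and A1: "A 1 \<le> \<beta> * b" and step: "\<And>t. 1 \<le> t \<Longrightarrow> t < T \<Longrightarrow> A (Suc t) \<le> \<beta> * (A t + k t)" and T: "1 \<le> T"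
  shows "(1 - \<beta>) * (\<Sum>t=1..T. A t) \<le> b + (\<Sum>t=1..T. k t)"
proof -
  \<comment> \<open>The extra term \<open>\<beta> * A n\<close> closes the induction: the left side
    grows by \<open>A (Suc n) - \<beta> * A n\<close>, which is at most \<open>k n\<close>.\<close>
  have "(1 - \<beta>) * (\<Sum>t=1..n. A t) + \<beta> * A n \<le> b + (\<Sum>t=1..<n. k t)" if "1 \<le> n" "n \<le> T" for n
    using that
  proof (induction n rule: nat_induct_at_least)
    case base
    have "\<beta> * b \<le> 1 * b" using \<beta> b by (intro mult_right_mono) auto
    then show ?case using A1 by (simp add: algebra_simps)
  next
    case (Suc n)
    have "\<beta> * k n \<le> 1 * k n" using \<beta> k by (intro mult_right_mono) auto
    then have "A (Suc n) \<le> \<beta> * A n + k n" using step[of n] Suc by (simp add: algebra_simps)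
    then show ?case using Suc by (simp add: algebra_simps)
  qed
  from this[OF T order_refl]
  have "(1 - \<beta>) * (\<Sum>t=1..T. A t) + \<beta> * A T \<le> b + (\<Sum>t=1..<T. k t)" .
  moreover have "0 \<le> \<beta> * A T" using \<beta> A by simp
  moreover have "(\<Sum>t=1..<T. k t) \<le> (\<Sum>t=1..T. k t)" using k by (intro sum_mono2) auto
  ultimately show ?thesis by linarith
qed

section \<open>The bound along one trajectory\<close>

lemma smooth_step_le:
  fixes X :: "'a::euclidean_space"
  assumes sm: "joint_smooth S F L\<^sub>0 L\<^sub>1 q" and L: "0 \<le> L\<^sub>0" "0 \<le> L\<^sub>1" "0 \<le> q" "q \<le> 1"
    and X: "X \<in> S" "Y \<in> S" and step: "norm (X - Y) \<le> c"
  shows "norm (grad S F X - grad S F Y)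
    \<le> (L\<^sub>0 + (1 - q) * L\<^sub>1 + q * L\<^sub>1 * norm (grad S F X)) * c"
proof -
  have "norm (grad S F X - grad S F Y)
      \<le> (L\<^sub>0 + L\<^sub>1 * pow0 (norm (grad S F X)) q) * norm (X - Y)"
    using sm X by (auto simp: joint_smooth_def)
  also have "\<dots> \<le> (L\<^sub>0 + (1 - q) * L\<^sub>1 + q * L\<^sub>1 * norm (grad S F X)) * norm (X - Y)"
    by (intro mult_right_mono smoothness_constant_le L(2-4)) auto
  also have "\<dots> \<le> (L\<^sub>0 + (1 - q) * L\<^sub>1 + q * L\<^sub>1 * norm (grad S F X)) * c"
    using step L by (intro mult_left_mono) auto
  finally show ?thesis .
qed

lemma layerwise_step_norm_le:
  fixes Q :: "real^'m::finite^'n::finite^'l::finite"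
  assumes spec: "\<And>l. spectral_condition smin smax (N l) (Q $ l)"
    and rank: "\<And>l. rank (N l) \<le> r l" and s: "0 \<le> smin" "0 \<le> smax"
  shows "norm Q \<le> smax * sqrt (\<Sum>l\<in>UNIV. real (r l))"
proof -
  have "(norm Q)\<^sup>2 = (\<Sum>l\<in>UNIV. (norm (Q $ l))\<^sup>2)" by (rule norm_vec_square)
  also have "\<dots> \<le> (\<Sum>l\<in>UNIV. smax\<^sup>2 * real (r l))"
  proof (rule sum_mono)
    fix l
    have "norm (Q $ l) \<le> smax * sqrt (real (rank (N l)))" by (rule spectral_condition_norm[OF spec s])
    also have "\<dots> \<le> smax * sqrt (real (r l))" using rank s by (intro mult_left_mono) auto
    finally have "(norm (Q $ l))\<^sup>2 \<le> (smax * sqrt (real (r l)))\<^sup>2" by (rule power_mono) simp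
    then show "(norm (Q $ l))\<^sup>2 \<le> smax\<^sup>2 * real (r l)" by (simp add: power_mult_distrib)
  qed
  also have "\<dots> = (smax * sqrt (\<Sum>l\<in>UNIV. real (r l)))\<^sup>2"
    by (simp add: power_mult_distrib sum_nonneg sum_distrib_left)
  finally show ?thesis by (rule power2_le_imp_le) (use s in \<open>simp add: sum_nonneg\<close>)
qed

text \<open>By linearity, subtracting the averaged errors leaves a recursion without noise. Starting
  from \<open>M 0 = 0\<close> acts like an initial bias \<open>- g 1\<close>, already contracted
  once at time 1; this is the origin of \<open>G\<^sub>0\<close>.\<close>

lemma momentum_error:
  fixes g G M :: "nat \<Rightarrow> 'b::real_vector"
  assumes M0: "M 0 = 0" and M: "\<And>t. t \<in> {1..T} \<Longrightarrow> M t = \<beta> *\<^sub>R M (t - 1) + (1 - \<beta>) *\<^sub>R G t"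
  defines "Z \<equiv> \<lambda>t. M t - g t - momentum \<beta> (\<lambda>s. G s - g s) t"
  shows "1 \<le> T \<Longrightarrow> Z 1 = - \<beta> *\<^sub>R g 1"
    and "1 \<le> t \<Longrightarrow> t < T \<Longrightarrow> Z (Suc t) = \<beta> *\<^sub>R (Z t + (g t - g (Suc t)))"
  using M[of 1] M[of "Suc t"] M0 by (auto simp: Z_def algebra_simps)

text \<open>The descent inequality is telescoped. Because the smoothness constant depends on the
  gradient, the sum of nuclear norms then occurs on both sides and is collected on the left.\<close>

lemma muon_path_bound:
  fixes S :: "(real^'m::finite^'n::finite^'l::finite) set"
    and X G M N Q :: "nat \<Rightarrow> real^'m^'n^'l" and r :: "'l \<Rightarrow> nat"
  assumes S: "subspace S" and sm: "joint_smooth S F L\<^sub>0 L\<^sub>1 q"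
    and L: "0 \<le> L\<^sub>0" "0 \<le> L\<^sub>1" "0 \<le> q" "q \<le> 1"
    and XS: "\<And>t. t \<in> {1..T + 1} \<Longrightarrow> X t \<in> S" and M0: "M 0 = 0"
    and M: "\<And>t. t \<in> {1..T} \<Longrightarrow> M t = \<beta>\<^sub>1 *\<^sub>R M (t - 1) + (1 - \<beta>\<^sub>1) *\<^sub>R G t"
    and N: "\<And>t. t \<in> {1..T} \<Longrightarrow> N t = \<beta>\<^sub>2 *\<^sub>R M t + (1 - \<beta>\<^sub>2) *\<^sub>R G t"
    and X: "\<And>t. t \<in> {1..T} \<Longrightarrow> X (t + 1) = X t - \<gamma> *\<^sub>R Q t"
    and spec: "\<And>t l. t \<in> {1..T} \<Longrightarrow> spectral_condition smin smax (N t $ l) (Q t $ l)"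
    and rank_N: "\<And>t l. t \<in> {1..T} \<Longrightarrow> rank (N t $ l) \<le> r l"
    and rank_E: "\<And>t l. t \<in> {1..T} \<Longrightarrow> rank (N t $ l - grad S F (X t) $ l) \<le> r l"
    and T: "1 \<le> T" and \<beta>: "0 \<le> \<beta>\<^sub>1" "\<beta>\<^sub>1 < 1" "0 \<le> \<beta>\<^sub>2" "\<beta>\<^sub>2 \<le> 1" and \<gamma>: "0 < \<gamma>"
    and s: "0 < smin" "smin \<le> smax"
  defines "Lhat \<equiv> L\<^sub>0 + (1 - q) * L\<^sub>1" and "R\<^sub>0 \<equiv> (\<Sum>l\<in>UNIV. real (r l))"
    and "G\<^sub>0 \<equiv> (\<Sum>l\<in>UNIV. sqrt (real (r l)) * norm (grad S F (X 1) $ l))"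
    and "W \<equiv> \<lambda>t. \<beta>\<^sub>2 *\<^sub>R momentum \<beta>\<^sub>1 (\<lambda>s. G s - grad S F (X s)) t + (1 - \<beta>\<^sub>2) *\<^sub>R (G t - grad S F (X t))"
  shows "(smin - \<gamma> * smax\<^sup>2 * q * L\<^sub>1 * R\<^sub>0 / 2 - 2 * \<gamma> * smax\<^sup>2 * q * L\<^sub>1 * R\<^sub>0 / (1 - \<beta>\<^sub>1))
      * (\<Sum>t=1..T. \<Sum>l\<in>UNIV. nuclear_norm (grad S F (X t) $ l))
    \<le> (F (X 1) - F (X (T + 1))) / \<gamma> + 2 * \<beta>\<^sub>2 * smax * G\<^sub>0 / (1 - \<beta>\<^sub>1)
      + 2 * smax * (\<Sum>t=1..T. \<Sum>l\<in>UNIV. sqrt (real (r l)) * norm (W t $ l))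
      + real T * (2 * \<gamma> * \<beta>\<^sub>2 * smax\<^sup>2 * Lhat / (1 - \<beta>\<^sub>1) * R\<^sub>0 + \<gamma> * smax\<^sup>2 * Lhat * R\<^sub>0 / 2)"
proof -
  define g where "g t = grad S F (X t)" for t
  define n where "n t = (\<Sum>l\<in>UNIV. nuclear_norm (g t $ l))" for t
  \<comment> \<open>Dominates the local smoothness constant at \<open>X t\<close>, with the
    Frobenius norm of the gradient replaced by nuclear norms so that it can be absorbed;
    \<open>c\<close> below bounds the length of one step.\<close>
  define K where "K t = Lhat + q * L\<^sub>1 * n t" for t
  define c where "c = \<gamma> * smax * sqrt R\<^sub>0"
  define V where "V = momentum \<beta>\<^sub>1 (\<lambda>s. G s - g s)"
  define Z where "Z t = M t - g t - V t" for t
  define A where "A t = (\<Sum>l\<in>UNIV. sqrt (real (r l)) * norm (Z t $ l))" for t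
  define w where "w t = (\<Sum>l\<in>UNIV. sqrt (real (r l)) * norm (W t $ l))" for t
  have R0: "0 \<le> R\<^sub>0" by (simp add: R\<^sub>0_def sum_nonneg)
  have Lhat: "0 \<le> Lhat" using L by (simp add: Lhat_def)
  have qL: "0 \<le> q * L\<^sub>1" using L by simp
  have n0: "0 \<le> n t" for t by (simp add: n_def sum_nonneg nuclear_norm_nonneg)
  have K0: "0 \<le> K t" for t using Lhat qL n0 by (simp add: K_def)
  have c0: "0 \<le> c" using \<gamma> s R0 by (simp add: c_def)
  have cR: "sqrt R\<^sub>0 * c = \<gamma> * smax * R\<^sub>0" using R0 by (simp add: c_def)
  have c2: "c\<^sup>2 = \<gamma>\<^sup>2 * smax\<^sup>2 * R\<^sub>0" using R0 by (simp add: c_def power_mult_distrib)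
  have gn: "norm (g t) \<le> n t" for t
    using norm_le_sum_norm_nth[of "g t"] sum_mono[of UNIV "\<lambda>l. norm (g t $ l)" "\<lambda>l. nuclear_norm (g t $ l)"]
    by (simp add: n_def frobenius_le_nuclear_norm)
  have norm_step: "norm (\<gamma> *\<^sub>R Q t) \<le> c" if t: "t \<in> {1..T}" for t
  proof -
    have "norm (Q t) \<le> smax * sqrt R\<^sub>0" unfolding R\<^sub>0_def
      by (rule layerwise_step_norm_le[OF spec[OF t] rank_N[OF t]]) (use s in auto)
    then have "\<gamma> * norm (Q t) \<le> \<gamma> * (smax * sqrt R\<^sub>0)" using \<gamma> by (intro mult_left_mono) auto
    then show ?thesis using \<gamma> by (simp add: c_def mult.assoc)
  qed
  have drift: "norm (g t - g (Suc t)) \<le> c * K t" if t: "t \<in> {1..T}" for t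
  proof -
    have "norm (X t - X (t + 1)) \<le> c" using norm_step[OF t] X[OF t] by simp
    then have "norm (g t - g (Suc t)) \<le> (L\<^sub>0 + (1 - q) * L\<^sub>1 + q * L\<^sub>1 * norm (g t)) * c"
      using smooth_step_le[OF sm L XS XS, of t "t + 1"] t unfolding g_def by simp
    also have "\<dots> \<le> K t * c"
      using c0 mult_left_mono[OF gn qL] unfolding K_def Lhat_def by (intro mult_right_mono) auto
    finally show ?thesis by (simp add: mult.commute)
  qed
  have NZ: "N t - g t = \<beta>\<^sub>2 *\<^sub>R Z t + W t" if t: "t \<in> {1..T}" for t
    using N[OF t] by (simp add: W_def Z_def V_def g_def[abs_def] algebra_simps)
  have err: "sqrt (real (r l)) * norm (N t $ l - g t $ l)
      \<le> \<beta>\<^sub>2 * (sqrt (real (r l)) * norm (Z t $ l)) + sqrt (real (r l)) * norm (W t $ l)" if t: "t \<in> {1..T}" for t l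
  proof -
    have "N t $ l - g t $ l = \<beta>\<^sub>2 *\<^sub>R (Z t $ l) + W t $ l" using NZ[OF t] by (simp add: vec_eq_iff)
    then have "norm (N t $ l - g t $ l) \<le> \<beta>\<^sub>2 * norm (Z t $ l) + norm (W t $ l)"
      using norm_triangle_ineq[of "\<beta>\<^sub>2 *\<^sub>R (Z t $ l)" "W t $ l"] \<beta> by simp
    then have "sqrt (real (r l)) * norm (N t $ l - g t $ l) \<le> sqrt (real (r l)) * (\<beta>\<^sub>2 * norm (Z t $ l) + norm (W t $ l))"
      by (intro mult_left_mono) auto
    then show ?thesis by (simp add: algebra_simps)
  qed
  have inner: "smin * n t - 2 * smax * (\<beta>\<^sub>2 * A t + w t) \<le> g t \<bullet> Q t" if t: "t \<in> {1..T}" for t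
  proof -
    have "smin * n t - 2 * smax * (\<beta>\<^sub>2 * A t + w t)
      = (\<Sum>l\<in>UNIV. smin * nuclear_norm (g t $ l) - 2 * smax *
          (\<beta>\<^sub>2 * (sqrt (real (r l)) * norm (Z t $ l)) + sqrt (real (r l)) * norm (W t $ l)))"
      by (simp add: n_def A_def w_def sum_subtractf sum.distrib sum_distrib_left distrib_left)
    also have "\<dots> \<le> (\<Sum>l\<in>UNIV. g t $ l \<bullet> Q t $ l)"
    proof (rule sum_mono)
      fix l
      have "smin * nuclear_norm (g t $ l) - 2 * smax * (sqrt (real (r l)) * norm (N t $ l - g t $ l)) \<le> g t $ l \<bullet> Q t $ l"
        unfolding g_def by (rule layer_descent[OF spec[OF t] s rank_N[OF t] rank_E[OF t]])
      moreover have "2 * smax * (sqrt (real (r l)) * norm (N t $ l - g t $ l)) \<le> 2 * smax *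
          (\<beta>\<^sub>2 * (sqrt (real (r l)) * norm (Z t $ l)) + sqrt (real (r l)) * norm (W t $ l))"
        using s by (intro mult_left_mono err[OF t]) auto
      ultimately show "smin * nuclear_norm (g t $ l) - 2 * smax *
          (\<beta>\<^sub>2 * (sqrt (real (r l)) * norm (Z t $ l)) + sqrt (real (r l)) * norm (W t $ l)) \<le> g t $ l \<bullet> Q t $ l"
        by linarith
    qed
    finally show ?thesis by (simp add: inner_vec_def[of "g t"])
  qed
  have descent: "(F (X (Suc t)) - F (X t)) / \<gamma>
      \<le> - smin * n t + 2 * smax * (\<beta>\<^sub>2 * A t + w t) + \<gamma> * smax\<^sup>2 * R\<^sub>0 / 2 * K t" if t: "t \<in> {1..T}" for t
  proof -
    have "F (X (t + 1)) \<le> F (X t) + g t \<bullet> (X (t + 1) - X t)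
        + (L\<^sub>0 + L\<^sub>1 * pow0 (norm (g t)) q) / 2 * (norm (X (t + 1) - X t))\<^sup>2"
      unfolding g_def by (rule smooth_descent[OF S sm XS XS]) (use t in auto)
    also have "X (t + 1) - X t = - (\<gamma> *\<^sub>R Q t)" using X[OF t] by simp
    also have "(L\<^sub>0 + L\<^sub>1 * pow0 (norm (g t)) q) / 2 * (norm (- (\<gamma> *\<^sub>R Q t)))\<^sup>2 \<le> K t / 2 * c\<^sup>2"
    proof (intro mult_mono divide_right_mono)
      have "L\<^sub>0 + L\<^sub>1 * pow0 (norm (g t)) q \<le> L\<^sub>0 + (1 - q) * L\<^sub>1 + q * L\<^sub>1 * norm (g t)"
        by (rule smoothness_constant_le[OF L(2-4)]) simp
      then show "L\<^sub>0 + L\<^sub>1 * pow0 (norm (g t)) q \<le> K t"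
        using mult_left_mono[OF gn[of t] qL] by (simp add: K_def Lhat_def)
      show "(norm (- (\<gamma> *\<^sub>R Q t)))\<^sup>2 \<le> c\<^sup>2"
        using norm_step[OF t] by (intro power_mono) auto
    qed (use K0 in auto)
    finally have "F (X (Suc t)) - F (X t) \<le> - (\<gamma> * (g t \<bullet> Q t)) + K t / 2 * c\<^sup>2" by simp
    also have "\<dots> \<le> - (\<gamma> * (smin * n t - 2 * smax * (\<beta>\<^sub>2 * A t + w t))) + K t / 2 * c\<^sup>2"
      using mult_left_mono[OF inner[OF t], of \<gamma>] \<gamma> by simp
    also have "\<dots> = \<gamma> * (- smin * n t + 2 * smax * (\<beta>\<^sub>2 * A t + w t) + \<gamma> * smax\<^sup>2 * R\<^sub>0 / 2 * K t)"
      unfolding c2 by (simp add: power2_eq_square algebra_simps)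
    finally show ?thesis using \<gamma> by (simp add: divide_le_eq mult.commute)
  qed
  have A0: "0 \<le> A t" for t by (simp add: A_def sum_nonneg)
  have Zrec: "Z 1 = - \<beta>\<^sub>1 *\<^sub>R g 1" "\<And>t. 1 \<le> t \<Longrightarrow> t < T \<Longrightarrow> Z (Suc t) = \<beta>\<^sub>1 *\<^sub>R (Z t + (g t - g (Suc t)))"
    unfolding Z_def V_def using momentum_error[OF M0 M, where g = g] T by auto
  have G0: "0 \<le> G\<^sub>0" by (simp add: G\<^sub>0_def sum_nonneg)
  \<comment> \<open>A step of length at most \<open>c\<close> moves the gradient by at most
    \<open>c * K t\<close>, and Cauchy-Schwarz over the layers supplies the second
    \<open>sqrt R\<^sub>0\<close>.\<close>
  have "(1 - \<beta>\<^sub>1) * (\<Sum>t=1..T. A t) \<le> G\<^sub>0 + (\<Sum>t=1..T. \<gamma> * smax * R\<^sub>0 * K t)"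
  proof (rule sum_contractive_recursion_le[OF \<beta>(1) _ G0 _ A0 _ _ T])
    show "A 1 \<le> \<beta>\<^sub>1 * G\<^sub>0"
      using \<beta> by (simp add: A_def Zrec(1) G\<^sub>0_def g_def sum_distrib_left mult_ac del: One_nat_def)
    fix t assume t: "1 \<le> t" "t < T"
    have "A (Suc t) = \<beta>\<^sub>1 * (\<Sum>l\<in>UNIV. sqrt (real (r l)) * norm (Z t $ l + (g t - g (Suc t)) $ l))"
      using \<beta> by (simp add: A_def Zrec(2)[OF t] sum_distrib_left mult_ac)
    also have "\<dots> \<le> \<beta>\<^sub>1 * (A t + (\<Sum>l\<in>UNIV. sqrt (real (r l)) * norm ((g t - g (Suc t)) $ l)))"
      unfolding A_def sum.distrib[symmetric] distrib_left[symmetric]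
      by (intro mult_left_mono sum_mono norm_triangle_ineq \<beta>) auto
    also have "\<dots> \<le> \<beta>\<^sub>1 * (A t + \<gamma> * smax * R\<^sub>0 * K t)"
    proof (intro mult_left_mono add_left_mono \<beta>)
      have "(\<Sum>l\<in>UNIV. sqrt (real (r l)) * norm ((g t - g (Suc t)) $ l)) \<le> sqrt R\<^sub>0 * norm (g t - g (Suc t))"
        unfolding R\<^sub>0_def by (rule sum_sqrt_mult_norm_nth_le)
      also have "\<dots> \<le> sqrt R\<^sub>0 * (c * K t)" using R0 t by (intro mult_left_mono drift) auto
      also have "\<dots> = \<gamma> * smax * R\<^sub>0 * K t" using cR by (simp add: mult.assoc[symmetric])
      finally show "(\<Sum>l\<in>UNIV. sqrt (real (r l)) * norm ((g t - g (Suc t)) $ l)) \<le> \<gamma> * smax * R\<^sub>0 * K t" .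
    qed
    finally show "A (Suc t) \<le> \<beta>\<^sub>1 * (A t + \<gamma> * smax * R\<^sub>0 * K t)" .
  qed (use \<beta> \<gamma> s R0 K0 in auto)
  then have Asum: "(\<Sum>t=1..T. A t) \<le> (G\<^sub>0 + \<gamma> * smax * R\<^sub>0 * (\<Sum>t=1..T. K t)) / (1 - \<beta>\<^sub>1)"
    using \<beta> by (simp add: le_divide_eq sum_distrib_left mult.commute)
  define Ns where "Ns = (\<Sum>t=1..T. n t)"
  define As where "As = (\<Sum>t=1..T. A t)"
  define Ws where "Ws = (\<Sum>t=1..T. w t)"
  have Ks: "(\<Sum>t=1..T. K t) = real T * Lhat + q * L\<^sub>1 * Ns"
    by (simp add: K_def Ns_def sum.distrib sum_distrib_left)
  have Ns0: "0 \<le> Ns" by (simp add: Ns_def sum_nonneg n0)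
  have "(F (X (T + 1)) - F (X 1)) / \<gamma> = (\<Sum>t=1..T. (F (X (Suc t)) - F (X t)) / \<gamma>)"
    unfolding sum_divide_distrib[symmetric] using sum_Suc_diff[of 1 T "\<lambda>t. F (X t)"] T by simp
  also have "\<dots> \<le> (\<Sum>t=1..T. - smin * n t + 2 * smax * (\<beta>\<^sub>2 * A t + w t) + \<gamma> * smax\<^sup>2 * R\<^sub>0 / 2 * K t)"
    by (rule sum_mono) (rule descent)
  also have "\<dots> = - smin * Ns + 2 * smax * (\<beta>\<^sub>2 * As + Ws) + \<gamma> * smax\<^sup>2 * R\<^sub>0 / 2 * (real T * Lhat + q * L\<^sub>1 * Ns)"
    unfolding Ks[symmetric] by (simp add: Ns_def As_def Ws_def sum.distrib sum_subtractf sum_negf sum_distrib_left distrib_left)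
  finally have main: "smin * Ns \<le> (F (X 1) - F (X (T + 1))) / \<gamma> + 2 * smax * \<beta>\<^sub>2 * As + 2 * smax * Ws
      + \<gamma> * smax\<^sup>2 * R\<^sub>0 / 2 * (real T * Lhat + q * L\<^sub>1 * Ns)"
    by (simp add: diff_divide_distrib algebra_simps)
  have "2 * smax * \<beta>\<^sub>2 * As \<le> 2 * smax * \<beta>\<^sub>2 * ((G\<^sub>0 + \<gamma> * smax * R\<^sub>0 * (real T * Lhat + q * L\<^sub>1 * Ns)) / (1 - \<beta>\<^sub>1))"
    using Asum s \<beta> unfolding As_def Ks by (intro mult_left_mono) auto
  also have "\<dots> = 2 * \<beta>\<^sub>2 * smax * G\<^sub>0 / (1 - \<beta>\<^sub>1) + real T * (2 * \<gamma> * \<beta>\<^sub>2 * smax\<^sup>2 * Lhat / (1 - \<beta>\<^sub>1) * R\<^sub>0)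
      + \<beta>\<^sub>2 * (2 * \<gamma> * smax\<^sup>2 * q * L\<^sub>1 * R\<^sub>0 / (1 - \<beta>\<^sub>1) * Ns)"
    by (simp add: power2_eq_square add_divide_distrib algebra_simps)
  \<comment> \<open>Here \<open>\<beta>\<^sub>2\<close> is estimated by \<open>1\<close>, only in
    the summand that moves to the left; hence \<open>\<Delta>\<close> is free of
    \<open>\<beta>\<^sub>2\<close> while the right side keeps it.\<close>
  also have "\<beta>\<^sub>2 * (2 * \<gamma> * smax\<^sup>2 * q * L\<^sub>1 * R\<^sub>0 / (1 - \<beta>\<^sub>1) * Ns) \<le> 1 * (2 * \<gamma> * smax\<^sup>2 * q * L\<^sub>1 * R\<^sub>0 / (1 - \<beta>\<^sub>1) * Ns)"
    using \<beta> \<gamma> L R0 Ns0 s by (intro mult_right_mono) auto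
  finally have "smin * Ns \<le> (F (X 1) - F (X (T + 1))) / \<gamma> + 2 * \<beta>\<^sub>2 * smax * G\<^sub>0 / (1 - \<beta>\<^sub>1)
      + real T * (2 * \<gamma> * \<beta>\<^sub>2 * smax\<^sup>2 * Lhat / (1 - \<beta>\<^sub>1) * R\<^sub>0)
      + 2 * \<gamma> * smax\<^sup>2 * q * L\<^sub>1 * R\<^sub>0 / (1 - \<beta>\<^sub>1) * Ns + 2 * smax * Ws
      + \<gamma> * smax\<^sup>2 * R\<^sub>0 / 2 * (real T * Lhat + q * L\<^sub>1 * Ns)"
    using main by linarith
  then have "(smin - \<gamma> * smax\<^sup>2 * q * L\<^sub>1 * R\<^sub>0 / 2 - 2 * \<gamma> * smax\<^sup>2 * q * L\<^sub>1 * R\<^sub>0 / (1 - \<beta>\<^sub>1)) * Ns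
    \<le> (F (X 1) - F (X (T + 1))) / \<gamma> + 2 * \<beta>\<^sub>2 * smax * G\<^sub>0 / (1 - \<beta>\<^sub>1) + 2 * smax * Ws
      + real T * (2 * \<gamma> * \<beta>\<^sub>2 * smax\<^sup>2 * Lhat / (1 - \<beta>\<^sub>1) * R\<^sub>0 + \<gamma> * smax\<^sup>2 * Lhat * R\<^sub>0 / 2)"
    by (simp add: algebra_simps add_divide_distrib)
  then show ?thesis by (simp add: Ns_def Ws_def n_def w_def g_def)
qed

lemma momentum_nth: "momentum \<beta> e t $ l = momentum \<beta> (\<lambda>s. e s $ l) t"
  by (induction t) auto

lemma momentum_cong: "(\<And>s. s \<in> {1..t} \<Longrightarrow> e s = e' s) \<Longrightarrow> momentum \<beta> e t = momentum \<beta> e' t"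
  by (induction t) auto

section \<open>The padded parameter space and the trajectories inside it\<close>

lemma subspace_param_space: "subspace (param_space I J)"
  by (auto simp: subspace_def param_space_def)

text \<open>Orthogonal projection onto the parameter space. Composition with it turns functions
  controlled on that space into functions on the whole matrix type, as Borel measurability
  requires.\<close>

definition param_proj ::
    "('l::finite \<Rightarrow> 'n::finite set) \<Rightarrow> ('l \<Rightarrow> 'm::finite set) \<Rightarrow> real^'m^'n^'l \<Rightarrow> real^'m^'n^'l" where
  "param_proj I J X = (\<chi> l i j. if i \<in> I l \<and> j \<in> J l then X $ l $ i $ j else 0)"

lemma linear_param_proj: "linear (param_proj I J)"
  by (rule linearI) (auto simp: param_proj_def vec_eq_iff)

lemma param_proj_in: "param_proj I J X \<in> param_space I J"
  by (auto simp: param_proj_def param_space_def)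

lemma param_proj_ident: "X \<in> param_space I J \<Longrightarrow> param_proj I J X = X"
  by (auto simp: param_proj_def param_space_def vec_eq_iff)

lemma inner_param_proj: "G \<in> param_space I J \<Longrightarrow> G \<bullet> param_proj I J X = G \<bullet> X"
  unfolding inner_vec_def by (intro sum.cong refl) (auto simp: param_proj_def param_space_def)

lemma layerwise_muon_vec:
  assumes "layerwise_muon S f orth \<beta>\<^sub>1 \<beta>\<^sub>2 \<gamma> T X\<^sub>1 \<xi> X G M N" "t \<in> {1..T}"
  shows "G t = grad S (\<lambda>Y. f Y (\<xi> t)) (X t)"
    and "M t = \<beta>\<^sub>1 *\<^sub>R M (t - 1) + (1 - \<beta>\<^sub>1) *\<^sub>R G t"
    and "N t = \<beta>\<^sub>2 *\<^sub>R M t + (1 - \<beta>\<^sub>2) *\<^sub>R G t"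
    and "X (t + 1) = X t - \<gamma> *\<^sub>R (\<chi> l. orth t l (N t $ l))"
  unfolding vec_eq_iff[where 'b = "'l::finite"] using assms unfolding layerwise_muon_def
  by (simp_all only: vector_add_component vector_minus_component vector_scaleR_component vec_lambda_beta) blast+

text \<open>\<open>X (Suc t)\<close> and \<open>M t\<close> are carried together, since the next
  \<open>N\<close> is built from the gradient at the former and from the latter. The linear steps
  stay in the subspace, and the routine inherits zero rows and columns.\<close>

lemma layerwise_muon_in_param_space:
  assumes muon: "layerwise_muon (param_space I J) f orth \<beta>\<^sub>1 \<beta>\<^sub>2 \<gamma> T X\<^sub>1 \<xi> X G M N"
    and X1: "X\<^sub>1 \<in> param_space I J"
    and diff: "\<And>t Y. t \<in> {1..T} \<Longrightarrow> Y \<in> param_space I J \<Longrightarrow>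
      (\<lambda>Z. f Z (\<xi> t)) differentiable (at Y within param_space I J)"
    and spec: "\<And>t l. t \<in> {1..T} \<Longrightarrow> spectral_condition smin smax (N t $ l) (orth t l (N t $ l))"
    and t: "t \<in> {1..T + 1}"
  shows "X t \<in> param_space I J"
proof -
  note S = subspace_param_space[of I J]
  have "X (Suc t) \<in> param_space I J \<and> M t \<in> param_space I J" if "t \<le> T" for t
    using that
  proof (induction t)
    case 0
    then show ?case using muon X1 subspace_0[OF S] by (simp add: layerwise_muon_def)
  next
    case (Suc t)
    then have IH: "X (Suc t) \<in> param_space I J" "M t \<in> param_space I J" and t: "Suc t \<in> {1..T}" by auto
    have G: "G (Suc t) \<in> param_space I J"
      unfolding layerwise_muon_vec(1)[OF muon t] by (rule grad_props(1)[OF S IH(1) diff[OF t IH(1)]])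
    have M: "M (Suc t) \<in> param_space I J"
      unfolding layerwise_muon_vec(2)[OF muon t] using IH(2) G by (simp add: S subspace_add subspace_scale)
    have N: "N (Suc t) \<in> param_space I J"
      unfolding layerwise_muon_vec(3)[OF muon t] using M G by (simp add: S subspace_add subspace_scale)
    have "(\<chi> l. orth (Suc t) l (N (Suc t) $ l)) \<in> param_space I J"
      unfolding param_space_def
    proof (intro CollectI allI impI)
      fix l i j assume ij: "i \<notin> I l \<or> j \<notin> J l"
      show "(\<chi> l. orth (Suc t) l (N (Suc t) $ l)) $ l $ i $ j = 0"
        unfolding vec_lambda_beta
        by (rule spectral_condition_support[OF spec[OF t]]) (use ij N in \<open>auto simp: param_space_def\<close>)
    qed
    then have "X (Suc t + 1) \<in> param_space I J"
      unfolding layerwise_muon_vec(4)[OF muon t] using IH(1) by (simp add: S subspace_diff subspace_scale)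
    then show ?case using M by simp
  qed
  from this[of "t - 1"] t show ?thesis by (simp add: le_diff_conv)
qed

theorem theorem3p1:
  fixes I :: "'l::finite \<Rightarrow> 'n::finite set" and J :: "'l \<Rightarrow> 'm::finite set"
    and S :: "(real^'m^'n^'l) set"
    and D :: "'x measure" and f :: "real^'m^'n^'l \<Rightarrow> 'x \<Rightarrow> real" and F :: "real^'m^'n^'l \<Rightarrow> real"
    and P :: "'w measure" and \<F> :: "nat \<Rightarrow> 'w measure" and \<xi> :: "nat \<Rightarrow> 'w \<Rightarrow> 'x"
    and X G M N :: "nat \<Rightarrow> 'w \<Rightarrow> real^'m^'n^'l" and X\<^sub>1 :: "real^'m^'n^'l"
    and orth :: "'w \<Rightarrow> nat \<Rightarrow> 'l \<Rightarrow> real^'m^'n \<Rightarrow> real^'m^'n"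
    and Fstar L\<^sub>0 L\<^sub>1 q \<beta>\<^sub>1 \<beta>\<^sub>2 \<gamma> \<sigma>min \<sigma>max :: real
    and \<sigma> :: "'l \<Rightarrow> real" and r :: "'l \<Rightarrow> nat" and T :: nat
    and Lhat R\<^sub>0 S\<^sub>0 G\<^sub>0 \<Delta> :: real
  defines "S \<equiv> param_space I J"
  assumes D_prob: "prob_space D"
    and f_differentiable: "\<And>x Y. x \<in> space D \<Longrightarrow> Y \<in> S \<Longrightarrow> (\<lambda>Z. f Z x) differentiable (at Y within S)"
    and f_integrable: "\<And>Y. Y \<in> S \<Longrightarrow> integrable D (f Y)"
    and F_expectation: "\<And>Y. Y \<in> S \<Longrightarrow> F Y = (\<integral>x. f Y x \<partial>D)"
    and lower_bounded: "\<And>Y. Y \<in> S \<Longrightarrow> Fstar \<le> F Y"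
    and smoothness_constants: "0 < L\<^sub>0" "0 \<le> L\<^sub>1" "0 \<le> q" "q \<le> 1"
    and smooth: "joint_smooth S F L\<^sub>0 L\<^sub>1 q"
    and \<sigma>_nonneg: "\<And>l. 0 \<le> \<sigma> l"
    and variance: "layerwise_variance S D f F \<sigma>"
    and P_prob: "prob_space P"
    and history: "filtration (space P) \<F>" "\<And>t. subalgebra P (\<F> t)"
    and sample_measurable: "\<And>t. t \<in> {1..T} \<Longrightarrow> \<xi> t \<in> \<F> t \<rightarrow>\<^sub>M D"
    and sample_law: "\<And>t. t \<in> {1..T} \<Longrightarrow> distr P D (\<xi> t) = D"
    and sample_indep: "\<And>t. t \<in> {1..T} \<Longrightarrow>
          prob_space.indep_set P (sets (\<F> (t - 1))) (sets (vimage_algebra (space P) (\<xi> t) D))"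
    and X_measurable: "\<And>t. t \<in> {1..T} \<Longrightarrow> X t \<in> borel_measurable (\<F> (t - 1))"
    and T_pos: "1 \<le> T"
    and parameters: "0 \<le> \<beta>\<^sub>1" "\<beta>\<^sub>1 < 1" "0 \<le> \<beta>\<^sub>2" "\<beta>\<^sub>2 \<le> 1" "0 < \<gamma>" "0 < \<sigma>min" "0 < \<sigma>max"
    and X\<^sub>1_in_S: "X\<^sub>1 \<in> S"
    and muon: "\<And>\<omega>. \<omega> \<in> space P \<Longrightarrow>
          layerwise_muon S f (orth \<omega>) \<beta>\<^sub>1 \<beta>\<^sub>2 \<gamma> T X\<^sub>1
            (\<lambda>t. \<xi> t \<omega>) (\<lambda>t. X t \<omega>) (\<lambda>t. G t \<omega>) (\<lambda>t. M t \<omega>) (\<lambda>t. N t \<omega>)"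
    and spectral: "\<And>\<omega> t l. \<omega> \<in> space P \<Longrightarrow> t \<in> {1..T} \<Longrightarrow>
          spectral_condition \<sigma>min \<sigma>max (N t \<omega> $ l) (orth \<omega> t l (N t \<omega> $ l))"
    and rank_N: "\<And>\<omega> t l. \<omega> \<in> space P \<Longrightarrow> t \<in> {1..T} \<Longrightarrow> rank (N t \<omega> $ l) \<le> r l"
    and rank_error: "\<And>\<omega> t l. \<omega> \<in> space P \<Longrightarrow> t \<in> {1..T} \<Longrightarrow>
          rank (N t \<omega> $ l - grad S F (X t \<omega>) $ l) \<le> r l"
  defines "Lhat \<equiv> L\<^sub>0 + (1 - q) * L\<^sub>1"
    and "R\<^sub>0 \<equiv> (\<Sum>l\<in>UNIV. real (r l))"
    and "S\<^sub>0 \<equiv> (\<Sum>l\<in>UNIV. sqrt (real (r l)) * \<sigma> l)"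
    and "G\<^sub>0 \<equiv> (\<Sum>l\<in>UNIV. sqrt (real (r l)) * norm (grad S F X\<^sub>1 $ l))"
    and "\<Delta> \<equiv> \<sigma>min - \<gamma> * \<sigma>max\<^sup>2 * q * L\<^sub>1 * R\<^sub>0 / 2 - 2 * \<gamma> * \<sigma>max\<^sup>2 * q * L\<^sub>1 * R\<^sub>0 / (1 - \<beta>\<^sub>1)"
  shows "\<Delta> * (1 / real T) *
           (\<Sum>t=1..T. \<Sum>l\<in>UNIV. (\<integral>\<omega>. nuclear_norm (grad S F (X t \<omega>) $ l) \<partial>P))
         \<le> (F X\<^sub>1 - Fstar) / (\<gamma> * real T)
           + 2 * \<beta>\<^sub>2 * \<sigma>max * G\<^sub>0 / (real T * (1 - \<beta>\<^sub>1))
           + 2 * (sqrt (1 - \<beta>\<^sub>1) + sqrt (2 * \<beta>\<^sub>1 * (1 - \<beta>\<^sub>1 * \<beta>\<^sub>2) * (1 - \<beta>\<^sub>2))) * \<sigma>max * S\<^sub>0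
           + 2 * \<gamma> * \<beta>\<^sub>2 * \<sigma>max\<^sup>2 * Lhat / (1 - \<beta>\<^sub>1) * R\<^sub>0
           + \<gamma> * \<sigma>max\<^sup>2 * Lhat * R\<^sub>0 / 2"
proof -
  interpret prob_space P by fact
  interpret D: prob_space D by fact
  define g where "g = grad S F"
  define p where "p = param_proj I J"
  define c where "c = \<gamma> * \<sigma>max * sqrt R\<^sub>0"
  define Q where "Q \<omega> t = (\<chi> l. orth \<omega> t l (N t \<omega> $ l))" for \<omega> t
  have S: "subspace S" unfolding S_def by (rule subspace_param_space)
  have pS: "p Y \<in> S" for Y unfolding p_def S_def by (rule param_proj_in)
  have pI: "p Y = Y" if "Y \<in> S" for Y using that unfolding p_def S_def by (rule param_proj_ident)
  have p_lin: "linear p" unfolding p_def by (rule linear_param_proj)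
  have p_cont: "continuous_on UNIV p"
    by (rule linear_continuous_on[OF p_lin[unfolded linear_conv_bounded_linear]])
  have \<F>_mono: "sets (\<F> i) \<subseteq> sets (\<F> j)" if "i \<le> j" for i j
    using filtration.sets_F_mono[OF history(1) that] .
  have \<xi>_space: "\<xi> t \<omega> \<in> space D" if "\<omega> \<in> space P" "t \<in> {1..T}" for \<omega> t
    using measurable_space[OF sample_measurable[OF that(2)]] that(1) history(2) by (auto simp: subalgebra_def)
  have \<xi>_meas: "\<xi> t \<in> P \<rightarrow>\<^sub>M D" if "t \<in> {1..T}" for t
    by (rule measurable_from_subalg[OF history(2) sample_measurable[OF that]])
  note vec = layerwise_muon_vec[OF muon]
  have XS: "X t \<omega> \<in> S" if \<omega>: "\<omega> \<in> space P" and t: "t \<in> {1..T + 1}" for t \<omega>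
    unfolding S_def
    by (rule layerwise_muon_in_param_space[OF muon[OF \<omega>, unfolded S_def] X\<^sub>1_in_S[unfolded S_def] _ spectral[OF \<omega>] t])
       (use f_differentiable \<xi>_space[OF \<omega>] in \<open>auto simp: S_def\<close>)
  have X1: "X 1 \<omega> = X\<^sub>1" if "\<omega> \<in> space P" for \<omega> using muon[OF that] by (simp add: layerwise_muon_def)
  have M0: "M 0 \<omega> = 0" if "\<omega> \<in> space P" for \<omega> using muon[OF that] by (simp add: layerwise_muon_def)
  have spec: "spectral_condition \<sigma>min \<sigma>max (N t \<omega> $ l) (Q \<omega> t $ l)" if "\<omega> \<in> space P" "t \<in> {1..T}" for \<omega> t l
    using spectral[OF that] by (simp add: Q_def)
  have nonneg: "0 \<le> R\<^sub>0" "0 \<le> S\<^sub>0" "0 \<le> G\<^sub>0" "0 \<le> Lhat"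
    using smoothness_constants \<sigma>_nonneg by (auto simp: R\<^sub>0_def S\<^sub>0_def G\<^sub>0_def Lhat_def sum_nonneg)
  define B where "B = sqrt (1 - \<beta>\<^sub>1) + sqrt (2 * \<beta>\<^sub>1 * (1 - \<beta>\<^sub>1 * \<beta>\<^sub>2) * (1 - \<beta>\<^sub>2))"
  have \<beta>12: "\<beta>\<^sub>1 * \<beta>\<^sub>2 < 1" using parameters by (smt (verit) mult_left_le)
  have B: "0 \<le> B" unfolding B_def using parameters \<beta>12 by simp
  show ?thesis
  proof (cases "\<sigma>min \<le> \<sigma>max")
    case False
    have N0: "N t \<omega> = 0" if "\<omega> \<in> space P" "t \<in> {1..T}" for \<omega> t
      using spectral_condition_min_le_max[OF spec[OF that]] False by (auto simp: vec_eq_iff)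
    have X_const: "X t \<omega> = X\<^sub>1" if \<omega>: "\<omega> \<in> space P" and "1 \<le> t" "t \<le> T" for \<omega> t
      using that(2,3)
    proof (induction t rule: nat_induct_at_least)
      case base
      then show ?case using X1[OF \<omega>] by simp
    next
      case (Suc t)
      then have t: "t \<in> {1..T}" by simp
      have "Q \<omega> t = 0" using spec[OF \<omega> t] N0[OF \<omega> t] by (simp add: spectral_condition_def vec_eq_iff)
      then show ?case using vec(4)[OF \<omega> t] Suc by (simp add: Q_def)
    qed
    have T1: "1 \<in> {1..T}" using T_pos by simp
    \<comment> \<open>As \<open>M 0 = 0\<close>, \<open>N 1\<close> is a positive multiple of
      \<open>G 1\<close>, so the first stochastic gradient vanishes at every outcome; unbiasedness
      then gives a zero gradient of \<open>F\<close> at \<open>X\<^sub>1\<close>.\<close>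
    have G1: "grad S (\<lambda>Y. f Y (\<xi> 1 \<omega>)) X\<^sub>1 = 0" if \<omega>: "\<omega> \<in> space P" for \<omega>
    proof -
      have M1: "M 1 \<omega> = (1 - \<beta>\<^sub>1) *\<^sub>R G 1 \<omega>" using vec(2)[OF \<omega> T1] M0[OF \<omega>] by simp
      have "(1 - \<beta>\<^sub>1 * \<beta>\<^sub>2) *\<^sub>R G 1 \<omega> = N 1 \<omega>"
        unfolding vec(3)[OF \<omega> T1] M1 by (simp add: algebra_simps)
      then have "G 1 \<omega> = 0" using N0[OF \<omega> T1] \<beta>12 by simp
      then show ?thesis using vec(1)[OF \<omega> T1] X1[OF \<omega>] by simp
    qed
    have "g X\<^sub>1 $ l = 0" for l
    proof -
      have meas: "(\<lambda>x. grad S (\<lambda>Y. f Y x) X\<^sub>1 $ l) \<in> borel_measurable D"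
        using variance X\<^sub>1_in_S unfolding layerwise_variance_def by (blast intro: borel_measurable_integrable)
      have "g X\<^sub>1 $ l = (\<integral>x. grad S (\<lambda>Y. f Y x) X\<^sub>1 $ l \<partial>distr P D (\<xi> 1))"
        unfolding sample_law[OF T1] using variance X\<^sub>1_in_S by (simp add: layerwise_variance_def g_def)
      also have "\<dots> = (\<integral>\<omega>. grad S (\<lambda>Y. f Y (\<xi> 1 \<omega>)) X\<^sub>1 $ l \<partial>P)"
        by (rule integral_distr[OF \<xi>_meas[OF T1] meas])
      also have "\<dots> = (\<integral>\<omega>. 0 \<partial>P)"
        by (rule Bochner_Integration.integral_cong) (simp_all add: G1 del: One_nat_def)
      finally show ?thesis by simp
    qed
    \<comment> \<open>With constant iterates the left side is zero, and only nonnegativity of the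
      right side remains.\<close>
    then have z: "(\<integral>\<omega>. nuclear_norm (grad S F (X t \<omega>) $ l) \<partial>P) = 0" if "t \<in> {1..T}" for t l
      using that X_const by (subst Bochner_Integration.integral_cong[where g = "\<lambda>_. 0"]) (auto simp: g_def nuclear_norm_0)
    have "Fstar \<le> F X\<^sub>1" using lower_bounded X\<^sub>1_in_S by simp
    then show ?thesis
      using parameters nonneg B unfolding B_def[symmetric] by (simp add: z)
  next
    case True
    have c0: "0 \<le> c" using parameters nonneg by (simp add: c_def)
    have step: "norm (X t \<omega> - X (t + 1) \<omega>) \<le> c" if \<omega>: "\<omega> \<in> space P" and t: "t \<in> {1..T}" for t \<omega>
    proof -
      have "norm (Q \<omega> t) \<le> \<sigma>max * sqrt R\<^sub>0" unfolding R\<^sub>0_def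
        by (rule layerwise_step_norm_le[OF spec[OF \<omega> t] rank_N[OF \<omega> t]]) (use parameters in auto)
      then have "\<gamma> * norm (Q \<omega> t) \<le> \<gamma> * (\<sigma>max * sqrt R\<^sub>0)" using parameters by (intro mult_left_mono) auto
      then show ?thesis using vec(4)[OF \<omega> t] parameters by (simp add: c_def Q_def mult.assoc)
    qed
    \<comment> \<open>The constant may grow with \<open>t\<close>: for integrability at finitely
      many times any bound uniform in the outcome suffices.\<close>
    have g_bound: "\<exists>C. \<forall>\<omega>\<in>space P. norm (g (X t \<omega>)) \<le> C" if "1 \<le> t" "t \<le> T" for t
      using that
    proof (induction t rule: nat_induct_at_least)
      case base
      then show ?case using X1 by (intro exI[of _ "norm (g X\<^sub>1)"]) simp
    next
      case (Suc t)
      then obtain C where C: "\<And>\<omega>. \<omega> \<in> space P \<Longrightarrow> norm (g (X t \<omega>)) \<le> C" by auto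
      have t: "t \<in> {1..T}" using Suc by simp
      have "norm (g (X (Suc t) \<omega>)) \<le> C + (Lhat + q * L\<^sub>1 * C) * c" if \<omega>: "\<omega> \<in> space P" for \<omega>
      proof -
        have "norm (g (X t \<omega>) - g (X (t + 1) \<omega>)) \<le> (Lhat + q * L\<^sub>1 * norm (g (X t \<omega>))) * c"
          unfolding g_def Lhat_def using t smoothness_constants
          by (intro smooth_step_le[OF smooth _ _ _ _ XS[OF \<omega>] XS[OF \<omega>] step[OF \<omega> t]]) auto
        also have "\<dots> \<le> (Lhat + q * L\<^sub>1 * C) * c"
          using C[OF \<omega>] smoothness_constants c0 by (intro mult_right_mono add_left_mono mult_left_mono) auto
        finally show ?thesis
          using C[OF \<omega>] norm_triangle_ineq4[of "g (X t \<omega>)" "g (X t \<omega>) - g (X (Suc t) \<omega>)"] by simp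
      qed
      then show ?case by blast
    qed
    have X_meas: "X t \<in> borel_measurable P" if "t \<in> {1..T}" for t
      by (rule measurable_from_subalg[OF history(2) X_measurable[OF that]])
    have gp_meas: "(\<lambda>Y. g (p Y)) \<in> borel_measurable borel" unfolding g_def
      by (rule borel_measurable_grad_compose[OF smooth p_cont]) (use pS in auto)
    have nth_meas: "(\<lambda>Y::real^'m^'n^'l. Y $ l) \<in> borel_measurable borel" for l
      by (intro borel_measurable_continuous_onI continuous_intros)
    \<comment> \<open>A measurable version of the nuclear norm: \<open>p\<close> is inserted so that
      \<open>gp_meas\<close> applies, and it acts as the identity along trajectories.\<close>
    define \<nu> where "\<nu> t l \<omega> = nuclear_norm (g (p (X t \<omega>)) $ l)" for t l \<omega>
    have \<nu>_eq: "\<nu> t l \<omega> = nuclear_norm (g (X t \<omega>) $ l)" if "\<omega> \<in> space P" "t \<in> {1..T}" for t l \<omega>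
      using pI[OF XS[OF that(1)]] that(2) by (simp add: \<nu>_def)
    have \<nu>_int: "integrable P (\<nu> t l)" if t: "t \<in> {1..T}" for t l
    proof -
      obtain C where C: "\<And>\<omega>. \<omega> \<in> space P \<Longrightarrow> norm (g (X t \<omega>)) \<le> C" using g_bound t by fastforce
      have meas: "\<nu> t l \<in> borel_measurable P" unfolding \<nu>_def
        by (intro measurable_compose[OF _ borel_measurable_continuous_onI[OF continuous_nuclear_norm]]
            measurable_compose[OF _ nth_meas] measurable_compose[OF _ gp_meas] X_meas[OF t])
      have "norm (\<nu> t l \<omega>) \<le> sqrt (real CARD('m)) * C" if \<omega>: "\<omega> \<in> space P" for \<omega>
      proof -
        have "\<nu> t l \<omega> \<le> sqrt (real (rank (g (X t \<omega>) $ l))) * norm (g (X t \<omega>) $ l)"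
          unfolding \<nu>_eq[OF \<omega> t] by (rule nuclear_norm_le_frobenius)
        also have "\<dots> \<le> sqrt (real CARD('m)) * C"
          using rank_bound[of "g (X t \<omega>) $ l"] order_trans[OF Finite_Cartesian_Product.norm_nth_le C[OF \<omega>]]
          by (intro mult_mono) auto
        finally have "\<nu> t l \<omega> \<le> sqrt (real CARD('m)) * C" .
        moreover have "0 \<le> \<nu> t l \<omega>" unfolding \<nu>_def by (rule nuclear_norm_nonneg)
        ultimately show ?thesis by simp
      qed
      then show ?thesis using meas by (intro integrable_const_bound[of _ "sqrt (real CARD('m)) * C"]) auto
    qed
    \<comment> \<open>The gradient error with past outcome and sample as separate arguments, as
      \<open>fresh_noise\<close> demands; \<open>p\<close> keeps the point in \<open>S\<close> at
      every outcome.\<close>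
    define H where "H t l z = (grad S (\<lambda>Y. f Y (snd z)) (p (X t (fst z))) - g (p (X t (fst z)))) $ l"
      for t :: nat and l :: 'l and z :: "'w \<times> 'x"
    define E where "E l t \<omega> = H t l (\<omega>, \<xi> t \<omega>)" for l t \<omega>
    have H_meas: "H t l \<in> borel_measurable (\<F> (t - 1) \<Otimes>\<^sub>M D)" if t: "t \<in> {1..T}" for t l
    proof -
      have 1: "(\<lambda>z. (X t (fst z), snd z)) \<in> \<F> (t - 1) \<Otimes>\<^sub>M D \<rightarrow>\<^sub>M borel \<Otimes>\<^sub>M D"
        by (intro measurable_Pair measurable_compose[OF measurable_fst X_measurable[OF t]] measurable_snd)
      have 2: "(\<lambda>(Y, x). grad S (\<lambda>Z. f Z x) (p Y)) \<in> borel_measurable (borel \<Otimes>\<^sub>M D)"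
      proof (rule grad_measurable[OF S _ _ p_lin])
        show "G \<bullet> p Y = G \<bullet> Y" if "G \<in> S" for G Y
          using that unfolding S_def p_def by (rule inner_param_proj)
      qed (use f_integrable f_differentiable pS in auto)
      have "(\<lambda>z. grad S (\<lambda>Y. f Y (snd z)) (p (X t (fst z)))) \<in> borel_measurable (\<F> (t - 1) \<Otimes>\<^sub>M D)"
        using measurable_compose[OF 1 2] by simp
      then show ?thesis unfolding H_def
        by (intro measurable_compose[OF _ nth_meas] borel_measurable_diff
            measurable_compose[OF measurable_fst measurable_compose[OF X_measurable[OF t] gp_meas]])
    qed
    have H_eq: "H t l (\<omega>, x) = grad S (\<lambda>Y. f Y x) (p (X t \<omega>)) $ l - g (p (X t \<omega>)) $ l" for t l \<omega> x
      by (simp add: H_def)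
    note var = variance[unfolded layerwise_variance_def, rule_format, OF pS, folded g_def]
    have H_int: "integrable D (\<lambda>x. H t l (\<omega>, x))" for t l \<omega>
      unfolding H_eq using var by simp
    have H_mean: "(\<integral>x. H t l (\<omega>, x) \<partial>D) = 0" for t l \<omega>
      unfolding H_eq using var by (simp add: D.prob_space)
    have H_int2: "integrable D (\<lambda>x. (norm (H t l (\<omega>, x)))\<^sup>2)" for t l \<omega>
      unfolding H_eq using var by simp
    have H_var: "(\<integral>x. (norm (H t l (\<omega>, x)))\<^sup>2 \<partial>D) \<le> (\<sigma> l)\<^sup>2" for t l \<omega>
      unfolding H_eq using var by simp
    note fresh = fresh_noise[where H = "H t l" and \<xi> = "\<xi> t" and \<G> = "\<F> (t - 1)" for t l,
        OF D_prob history(2) \<xi>_meas sample_law sample_indep H_meas H_int H_mean H_int2 H_var]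
    have E_int2: "integrable P (\<lambda>\<omega>. (norm (E l t \<omega>))\<^sup>2)" if "t \<in> {1..T}" for l t
      unfolding E_def by (rule fresh(1)[OF that that that that])
    have E_var: "(\<integral>\<omega>. (norm (E l t \<omega>))\<^sup>2 \<partial>P) \<le> (\<sigma> l)\<^sup>2" if "t \<in> {1..T}" for l t
      unfolding E_def by (rule fresh(2)[OF that that that that])
    have E_orth: "(\<integral>\<omega>. a \<omega> \<bullet> E l t \<omega> \<partial>P) = 0" if "t \<in> {1..T}" "a \<in> borel_measurable (\<F> (t - 1))"
      "integrable P (\<lambda>\<omega>. (norm (a \<omega>))\<^sup>2)" for a l t
      unfolding E_def by (rule fresh(3)[OF that(1) that(1) that(1) that(1) that(2,3)])
    have E_meas: "E l t \<in> borel_measurable (\<F> t)" if t: "t \<in> {1..T}" for l t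
    proof -
      have "(\<lambda>\<omega>. \<omega>) \<in> \<F> t \<rightarrow>\<^sub>M \<F> (t - 1)"
        by (rule measurable_from_subalg[OF _ measurable_ident_sets[OF refl]])
           (use history(2)[of t] history(2)[of "t - 1"] \<F>_mono[of "t - 1" t] in \<open>simp add: subalgebra_def\<close>)
      then have "(\<lambda>\<omega>. (\<omega>, \<xi> t \<omega>)) \<in> \<F> t \<rightarrow>\<^sub>M \<F> (t - 1) \<Otimes>\<^sub>M D"
        using sample_measurable[OF t] by (rule measurable_Pair)
      from measurable_compose[OF this H_meas[OF t, of l]] show ?thesis by (simp add: E_def[abs_def])
    qed
    define W where "W l t \<omega> = \<beta>\<^sub>2 *\<^sub>R momentum \<beta>\<^sub>1 (\<lambda>s. E l s \<omega>) t + (1 - \<beta>\<^sub>2) *\<^sub>R E l t \<omega>" for l t \<omega>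
    note W_noise = momentum_noise[where \<F> = \<F> and T = T and e = "E l" and c = "\<sigma> l" and t = t for l t,
        OF history(2) \<F>_mono E_meas E_int2 E_var E_orth parameters(1-4) \<sigma>_nonneg, folded W_def B_def]
    have W: "integrable P (\<lambda>\<omega>. norm (W l t \<omega>))" "(\<integral>\<omega>. norm (W l t \<omega>) \<partial>P) \<le> B * \<sigma> l"
      if t: "t \<in> {1..T}" for l t
      by (rule W_noise; (assumption | rule t))+
    define C0 where "C0 = (F X\<^sub>1 - Fstar) / \<gamma> + 2 * \<beta>\<^sub>2 * \<sigma>max * G\<^sub>0 / (1 - \<beta>\<^sub>1)
      + real T * (2 * \<gamma> * \<beta>\<^sub>2 * \<sigma>max\<^sup>2 * Lhat / (1 - \<beta>\<^sub>1) * R\<^sub>0 + \<gamma> * \<sigma>max\<^sup>2 * Lhat * R\<^sub>0 / 2)"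
    have path: "\<Delta> * (\<Sum>t=1..T. \<Sum>l\<in>UNIV. \<nu> t l \<omega>)
        \<le> C0 + 2 * \<sigma>max * (\<Sum>t=1..T. \<Sum>l\<in>UNIV. sqrt (real (r l)) * norm (W l t \<omega>))"
      if \<omega>: "\<omega> \<in> space P" for \<omega>
    proof -
      have E_eq: "E l s \<omega> = (G s \<omega> - g (X s \<omega>)) $ l" if "s \<in> {1..T}" for l s
        using vec(1)[OF \<omega> that] pI[OF XS[OF \<omega>], of s] that by (simp add: E_def H_def)
      have W_eq: "W l t \<omega> = (\<beta>\<^sub>2 *\<^sub>R momentum \<beta>\<^sub>1 (\<lambda>s. G s \<omega> - g (X s \<omega>)) t
          + (1 - \<beta>\<^sub>2) *\<^sub>R (G t \<omega> - g (X t \<omega>))) $ l" if "t \<in> {1..T}" for l t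
      proof -
        have "momentum \<beta>\<^sub>1 (\<lambda>s. E l s \<omega>) t = momentum \<beta>\<^sub>1 (\<lambda>s. (G s \<omega> - g (X s \<omega>)) $ l) t"
          by (rule momentum_cong) (use that in \<open>simp add: E_eq\<close>)
        then show ?thesis using that by (simp add: W_def E_eq momentum_nth)
      qed
      have "\<Delta> * (\<Sum>t=1..T. \<Sum>l\<in>UNIV. nuclear_norm (g (X t \<omega>) $ l))
        \<le> (F (X 1 \<omega>) - F (X (T + 1) \<omega>)) / \<gamma> + 2 * \<beta>\<^sub>2 * \<sigma>max * G\<^sub>0 / (1 - \<beta>\<^sub>1)
        + 2 * \<sigma>max * (\<Sum>t=1..T. \<Sum>l\<in>UNIV. sqrt (real (r l)) * norm ((\<beta>\<^sub>2 *\<^sub>R momentum \<beta>\<^sub>1 (\<lambda>s. G s \<omega> - g (X s \<omega>)) t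
          + (1 - \<beta>\<^sub>2) *\<^sub>R (G t \<omega> - g (X t \<omega>))) $ l))
        + real T * (2 * \<gamma> * \<beta>\<^sub>2 * \<sigma>max\<^sup>2 * Lhat / (1 - \<beta>\<^sub>1) * R\<^sub>0 + \<gamma> * \<sigma>max\<^sup>2 * Lhat * R\<^sub>0 / 2)"
        unfolding \<Delta>_def Lhat_def R\<^sub>0_def G\<^sub>0_def g_def X1[OF \<omega>, symmetric]
        by (rule muon_path_bound[where X = "\<lambda>t. X t \<omega>" and G = "\<lambda>t. G t \<omega>" and M = "\<lambda>t. M t \<omega>" and N = "\<lambda>t. N t \<omega>"
              and Q = "Q \<omega>", OF S smooth _ smoothness_constants(2-4) XS[OF \<omega>] M0[OF \<omega>] vec(2)[OF \<omega>] vec(3)[OF \<omega>]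
              vec(4)[OF \<omega>, folded Q_def] spec[OF \<omega>] rank_N[OF \<omega>] rank_error[OF \<omega>] T_pos parameters(1-6) True])
           (use smoothness_constants(1) in simp_all)
      \<comment> \<open>The lower bound is applied before integration, because the measurability
        assumed for the iterates stops at time \<open>T\<close>.\<close>
      moreover have "(F (X 1 \<omega>) - F (X (T + 1) \<omega>)) / \<gamma> \<le> (F X\<^sub>1 - Fstar) / \<gamma>"
        using lower_bounded[OF XS[OF \<omega>, of "T + 1"]] parameters X1[OF \<omega>] by (intro divide_right_mono) auto
      ultimately show ?thesis by (simp add: C0_def \<nu>_eq[OF \<omega>] W_eq)
    qed
    have "\<Delta> * (\<Sum>t=1..T. \<Sum>l\<in>UNIV. \<integral>\<omega>. \<nu> t l \<omega> \<partial>P) = (\<integral>\<omega>. \<Delta> * (\<Sum>t=1..T. \<Sum>l\<in>UNIV. \<nu> t l \<omega>) \<partial>P)"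
      by (simp add: Bochner_Integration.integral_sum \<nu>_int)
    \<comment> \<open>The path inequality is integrated as a whole, so \<open>\<Delta>\<close> may
      have either sign.\<close>
    also have "\<dots> \<le> (\<integral>\<omega>. C0 + 2 * \<sigma>max * (\<Sum>t=1..T. \<Sum>l\<in>UNIV. sqrt (real (r l)) * norm (W l t \<omega>)) \<partial>P)"
      by (rule integral_mono[OF _ _ path])
         (auto intro!: Bochner_Integration.integrable_sum integrable_mult_right Bochner_Integration.integrable_add \<nu>_int W(1))
    also have "\<dots> = C0 + 2 * \<sigma>max * (\<Sum>t=1..T. \<Sum>l\<in>UNIV. sqrt (real (r l)) * (\<integral>\<omega>. norm (W l t \<omega>) \<partial>P))"
    proof (subst Bochner_Integration.integral_add)
      show "integrable P (\<lambda>\<omega>. 2 * \<sigma>max * (\<Sum>t=1..T. \<Sum>l\<in>UNIV. sqrt (real (r l)) * norm (W l t \<omega>)))"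
        by (intro integrable_mult_right Bochner_Integration.integrable_sum W(1))
    qed (simp_all add: Bochner_Integration.integral_sum W(1) prob_space)
    also have "\<dots> \<le> C0 + 2 * \<sigma>max * (\<Sum>t=1..T. \<Sum>l\<in>UNIV. sqrt (real (r l)) * (B * \<sigma> l))"
      using parameters by (intro add_left_mono mult_left_mono sum_mono W(2)) auto
    also have "(\<Sum>t=1..T. \<Sum>l\<in>UNIV. sqrt (real (r l)) * (B * \<sigma> l)) = real T * (B * S\<^sub>0)"
      by (simp add: S\<^sub>0_def sum_distrib_left mult_ac)
    also have "(\<Sum>t=1..T. \<Sum>l\<in>UNIV. \<integral>\<omega>. \<nu> t l \<omega> \<partial>P)
        = (\<Sum>t=1..T. \<Sum>l\<in>UNIV. \<integral>\<omega>. nuclear_norm (grad S F (X t \<omega>) $ l) \<partial>P)"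
      by (intro sum.cong refl Bochner_Integration.integral_cong) (simp_all add: \<nu>_eq g_def)
    finally have "(1 / real T) * (\<Delta> * (\<Sum>t=1..T. \<Sum>l\<in>UNIV. \<integral>\<omega>. nuclear_norm (grad S F (X t \<omega>) $ l) \<partial>P))
        \<le> (1 / real T) * (C0 + 2 * \<sigma>max * (real T * (B * S\<^sub>0)))"
      by (rule mult_left_mono) simp
    also have "\<dots> = (F X\<^sub>1 - Fstar) / (\<gamma> * real T) + 2 * \<beta>\<^sub>2 * \<sigma>max * G\<^sub>0 / (real T * (1 - \<beta>\<^sub>1))
        + 2 * B * \<sigma>max * S\<^sub>0 + 2 * \<gamma> * \<beta>\<^sub>2 * \<sigma>max\<^sup>2 * Lhat / (1 - \<beta>\<^sub>1) * R\<^sub>0 + \<gamma> * \<sigma>max\<^sup>2 * Lhat * R\<^sub>0 / 2"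
      using T_pos by (simp add: C0_def distrib_left mult_ac)
    finally show ?thesis unfolding B_def by (simp add: mult_ac)
  qed
qed

end
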